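(* Let $\Bbbk$ be a field with $\operatorname{char}\Bbbk\ne 2$, and let $\mathcal P$ be a finitely generated operad over $\Bbbk$ of GK-dimension $1$. Then: (i) The Hilbert series of $\mathcal P$ is rational, and thus $\mathcal P$ is uniformly bounded. (ii) $\mathcal P$ is right noetherian.
   Context: "Operad" means a symmetric operad $\mathcal P$ in $\Bbbk$-vector spaces, given by right $\Bbbk\mathbb S_n$-modules $\mathcal P(n)$ ($n\ge 0$), an identity $1_{\mathcal P}\in\mathcal P(1)$ and partial compositions $\circ_i:\mathcal P(m)\otimes\mathcal P(n)\to\mathcal P(m+n-1)$, $1\le i\le m$, satisfying the usual unit, associativity and equivariance axioms. All operads are reduced ($\mathcal P(0)=0$) and locally finite ($\dim_\Bbbk\mathcal P(n)<\infty$). $\mathcal P$ is finitely generated if it is generated by finitely many elements as a symmetric operad. $\operatorname{GKdim}(\mathcal P)=\limsup_{n\to\infty}\log_n\bigl(\sum_{i=0}^n\dim\mathcal P(i)\bigr)$. The Hilbert series of $\mathcal P$ is $H_{\mathcal P}(t)=\sum_{n\ge 0}\dim\mathcal P(n)\,t^n$. $\mathcal P$ is uniformly bounded if there is a finite $N$ with $\dim\mathcal P(n)\le N$ for every $n$. A right ideal of $\mathcal P$ is an $\mathbb S$-submodule $I$ such that $x\circ_i\mu\in I$ for all $x\in I$, $\mu\in\mathcal P$ and $1\le i\le$ arity of $x$. $\mathcal P$ is right noetherian if its right ideals satisfy the ascending chain condition. *)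

theory Defs
  imports
    Complex_Main
    "HOL-Library.Extended_Real"
    "HOL-Combinatorics.Permutations"
    "HOL-Computational_Algebra.Computational_Algebra"
begin

section \<open>Block permutations\<close>

text \<open>
  Substituting an operation of arity \<open>n\<close> into input \<open>i\<close> of another operation moves an input
  \<open>k \<noteq> i\<close> of the latter to position \<open>outer_pos n i k\<close> of the composite; the inputs of the
  substituted operation occupy the positions \<open>i, \<dots>, i + n - 1\<close>.
\<close>

definition outer_pos :: "nat \<Rightarrow> nat \<Rightarrow> nat \<Rightarrow> nat" where
  "outer_pos n i k = (if k < i then k else k + n - 1)"

text \<open>
  For \<open>\<sigma>\<close> in \<open>S_m\<close> and \<open>\<tau>\<close> in \<open>S_n\<close> this is the permutation of \<open>{1..m + n - 1}\<close> which carries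
  the \<open>i\<close>-th block \<open>{i..i + n - 1}\<close> to \<open>{\<sigma> i..\<sigma> i + n - 1}\<close> by \<open>\<tau>\<close> and permutes the remaining
  \<open>m - 1\<close> points as \<open>\<sigma>\<close> does. It is the identity outside \<open>{1..m + n - 1}\<close>, because \<open>\<sigma>\<close> is the
  identity outside \<open>{1..m}\<close>; hence it does not depend on \<open>m\<close>.
\<close>

definition block_perm :: "nat \<Rightarrow> nat \<Rightarrow> (nat \<Rightarrow> nat) \<Rightarrow> (nat \<Rightarrow> nat) \<Rightarrow> nat \<Rightarrow> nat" where
  "block_perm n i \<sigma> \<tau> j =
     (if j < i then outer_pos n (\<sigma> i) (\<sigma> j)
      else if j < i + n then \<sigma> i + \<tau> (j - i + 1) - 1
      else outer_pos n (\<sigma> i) (\<sigma> (j + 1 - n)))"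

section \<open>Symmetric operads\<close>

text \<open>
  The components \<open>P n\<close> are linear subspaces of one ambient vector space \<open>'a\<close>. This is no
  restriction (take the direct sum of the components), and they need not be independent, since
  the structure maps carry their arities: \<open>act n x \<sigma>\<close> is the right action of \<open>\<sigma> \<in> S_n\<close> on
  \<open>x \<in> P n\<close>, and \<open>pcomp m n i x y\<close> is the partial composition of \<open>x \<in> P m\<close> with \<open>y \<in> P n\<close> at
  input \<open>i\<close>. Elements of \<open>S_n\<close> are functions permuting \<open>{1..n}\<close>. The values of the structure maps
  on other arguments are irrelevant.

  The equivariance axiom is the one of the endomorphism operad with the right action
  \<open>(f \<cdot> \<sigma>)(v\<^sub>1, \<dots>, v\<^sub>n) = f (v\<^bsub>\<sigma>\<inverse>(1)\<^esub>, \<dots>, v\<^bsub>\<sigma>\<inverse>(n)\<^esub>)\<close>.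
\<close>

locale symmetric_operad = vector_space scale
  for scale :: "'k::field \<Rightarrow> 'a::ab_group_add \<Rightarrow> 'a" +
  fixes P :: "nat \<Rightarrow> 'a set"
    and act :: "nat \<Rightarrow> 'a \<Rightarrow> (nat \<Rightarrow> nat) \<Rightarrow> 'a"
    and unit :: 'a
    and pcomp :: "nat \<Rightarrow> nat \<Rightarrow> nat \<Rightarrow> 'a \<Rightarrow> 'a \<Rightarrow> 'a"
  assumes subspace_P: "subspace (P n)"
    and act_closed: "\<lbrakk>\<sigma> permutes {1..n}; x \<in> P n\<rbrakk> \<Longrightarrow> act n x \<sigma> \<in> P n"
    and act_add: "\<lbrakk>\<sigma> permutes {1..n}; x \<in> P n; y \<in> P n\<rbrakk>
          \<Longrightarrow> act n (x + y) \<sigma> = act n x \<sigma> + act n y \<sigma>"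
    and act_scale: "\<lbrakk>\<sigma> permutes {1..n}; x \<in> P n\<rbrakk>
          \<Longrightarrow> act n (scale c x) \<sigma> = scale c (act n x \<sigma>)"
    and act_id: "x \<in> P n \<Longrightarrow> act n x id = x"
    and act_compose: "\<lbrakk>\<sigma> permutes {1..n}; \<tau> permutes {1..n}; x \<in> P n\<rbrakk>
          \<Longrightarrow> act n x (\<sigma> \<circ> \<tau>) = act n (act n x \<sigma>) \<tau>"
    and unit_in: "unit \<in> P 1"
    and pcomp_closed: "\<lbrakk>i \<in> {1..m}; x \<in> P m; y \<in> P n\<rbrakk> \<Longrightarrow> pcomp m n i x y \<in> P (m + n - 1)"
    and pcomp_add_left: "\<lbrakk>i \<in> {1..m}; x \<in> P m; x' \<in> P m; y \<in> P n\<rbrakk>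
          \<Longrightarrow> pcomp m n i (x + x') y = pcomp m n i x y + pcomp m n i x' y"
    and pcomp_add_right: "\<lbrakk>i \<in> {1..m}; x \<in> P m; y \<in> P n; y' \<in> P n\<rbrakk>
          \<Longrightarrow> pcomp m n i x (y + y') = pcomp m n i x y + pcomp m n i x y'"
    and pcomp_scale_left: "\<lbrakk>i \<in> {1..m}; x \<in> P m; y \<in> P n\<rbrakk>
          \<Longrightarrow> pcomp m n i (scale c x) y = scale c (pcomp m n i x y)"
    and pcomp_scale_right: "\<lbrakk>i \<in> {1..m}; x \<in> P m; y \<in> P n\<rbrakk>
          \<Longrightarrow> pcomp m n i x (scale c y) = scale c (pcomp m n i x y)"
    and unit_left: "x \<in> P n \<Longrightarrow> pcomp 1 n 1 unit x = x"
    and unit_right: "\<lbrakk>i \<in> {1..n}; x \<in> P n\<rbrakk> \<Longrightarrow> pcomp n 1 i x unit = x"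
    and sequential_assoc:
        "\<lbrakk>i \<in> {1..l}; j \<in> {1..m}; x \<in> P l; y \<in> P m; z \<in> P n\<rbrakk>
          \<Longrightarrow> pcomp (l + m - 1) n (i + j - 1) (pcomp l m i x y) z =
              pcomp l (m + n - 1) i x (pcomp m n j y z)"
    and parallel_assoc:
        "\<lbrakk>i \<in> {1..l}; k \<in> {1..l}; i < k; x \<in> P l; y \<in> P m; z \<in> P n\<rbrakk>
          \<Longrightarrow> pcomp (l + m - 1) n (k + m - 1) (pcomp l m i x y) z =
              pcomp (l + n - 1) m i (pcomp l n k x z) y"
    and equivariance:
        "\<lbrakk>i \<in> {1..m}; \<sigma> permutes {1..m}; \<tau> permutes {1..n}; x \<in> P m; y \<in> P n\<rbrakk>
          \<Longrightarrow> pcomp m n i (act m x \<sigma>) (act n y \<tau>) =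
              act (m + n - 1) (pcomp m n (\<sigma> i) x y) (block_perm n i \<sigma> \<tau>)"
begin

definition reduced :: bool where
  "reduced \<longleftrightarrow> P 0 = {0}"

definition locally_finite :: bool where
  "locally_finite \<longleftrightarrow> (\<forall>n. \<exists>B. finite B \<and> B \<subseteq> P n \<and> span B = P n)"

definition suboperad :: "(nat \<Rightarrow> 'a set) \<Rightarrow> bool" where
  "suboperad Q \<longleftrightarrow>
     (\<forall>n. subspace (Q n) \<and> Q n \<subseteq> P n) \<and>
     unit \<in> Q 1 \<and>
     (\<forall>n. \<forall>x\<in>Q n. \<forall>\<sigma>. \<sigma> permutes {1..n} \<longrightarrow> act n x \<sigma> \<in> Q n) \<and>
     (\<forall>m n. \<forall>i\<in>{1..m}. \<forall>x\<in>Q m. \<forall>y\<in>Q n. pcomp m n i x y \<in> Q (m + n - 1))"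

text \<open>A generator is given together with its arity, as a pair \<open>(n, x)\<close> with \<open>x \<in> P n\<close>.\<close>

definition generated_suboperad :: "(nat \<times> 'a) set \<Rightarrow> nat \<Rightarrow> 'a set" where
  "generated_suboperad X n = \<Inter> {Q n |Q. suboperad Q \<and> (\<forall>(k, x)\<in>X. x \<in> Q k)}"

definition finitely_generated :: bool where
  "finitely_generated \<longleftrightarrow>
     (\<exists>X. finite X \<and> X \<subseteq> Sigma UNIV P \<and> (\<forall>n. generated_suboperad X n = P n))"

text \<open>
  The conventions \<open>ln 0 = 0\<close> and \<open>x / 0 = 0\<close> only matter for \<open>n \<le> 1\<close> and for the zero operad.
  The latter gets dimension \<open>0\<close> here.
\<close>

definition GKdim :: ereal where
  "GKdim = limsup (\<lambda>n. ereal (log (real n) (real (\<Sum>i\<le>n. dim (P i)))))"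

definition hilbert_series :: "rat fps" where
  "hilbert_series = Abs_fps (\<lambda>n. of_nat (dim (P n)))"

definition uniformly_bounded :: bool where
  "uniformly_bounded \<longleftrightarrow> (\<exists>N. \<forall>n. dim (P n) \<le> N)"

definition right_ideal :: "(nat \<Rightarrow> 'a set) \<Rightarrow> bool" where
  "right_ideal I \<longleftrightarrow>
     (\<forall>n. subspace (I n) \<and> I n \<subseteq> P n) \<and>
     (\<forall>n. \<forall>x\<in>I n. \<forall>\<sigma>. \<sigma> permutes {1..n} \<longrightarrow> act n x \<sigma> \<in> I n) \<and>
     (\<forall>m n. \<forall>i\<in>{1..m}. \<forall>x\<in>I m. \<forall>\<mu>\<in>P n. pcomp m n i x \<mu> \<in> I (m + n - 1))"

definition right_noetherian :: bool where
  "right_noetherian \<longleftrightarrow>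
     (\<forall>I :: nat \<Rightarrow> nat \<Rightarrow> 'a set.
        (\<forall>k. right_ideal (I k)) \<and> (\<forall>k n. I k n \<subseteq> I (Suc k) n) \<longrightarrow>
        (\<exists>K. \<forall>k\<ge>K. \<forall>n. I k n = I K n))"

end

section \<open>Rational power series\<close>

text \<open>
  \<open>F = p / q\<close> is written without division, as the division of formal power series in the library
  is a division with remainder.
\<close>

definition rational_fps :: "'c::field fps \<Rightarrow> bool" where
  "rational_fps F \<longleftrightarrow> (\<exists>p q :: 'c poly. q \<noteq> 0 \<and> F * fps_of_poly q = fps_of_poly p)"

end

theory Submission
  imports Defs "HOL-Real_Asymp.Real_Asymp"
begin

text \<open>
  Let \<open>d\<close> bound the arities of finitely many generators. The proof shows that the alternating
  group \<open>A_n\<close> acts trivially on \<open>P n\<close> for all large \<open>n\<close>; call an arity \<open>n\<close> good if it does. In that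
  range the operad is a finitely generated graded module over something close to a polynomial ring,
  and the growth forces the support of this module to be at most one-dimensional.

  \<^emph>\<open>Good arities exist.\<close> If \<open>A_n\<close> acts nontrivially on \<open>P n\<close>, then \<open>dim (P n)\<close> is at least
  about \<open>n / 4\<close> (\<open>dim_ge_of_not_alt_fixed\<close>): the \<open>n div 2\<close> commuting transpositions of a
  perfect matching are simultaneously diagonalisable, as the characteristic is not \<open>2\<close>, and
  permuting the edges of the matching moves a nonconstant character to many others. If every window
  of \<open>d + 1\<close> consecutive large arities contained one that is not good, the growth would be quadratic.

  \<^emph>\<open>Good arities propagate\<close> (\<open>alt_fixed_propagates\<close>). For \<open>n > d\<close> the space \<open>P n\<close> is spanned by
  composites of an operation with one of arity between \<open>2\<close> and \<open>d\<close>. Do this twice. If the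
  preceding \<open>d\<close> arities are good, the two small operations can be moved to different inputs of the
  same operation, and by parallel associativity the composite is a composite with either of them
  performed last. Hence it is invariant under the even permutations of the complement of each of two
  disjoint blocks, and these generate \<open>A_n\<close>.

  \<^emph>\<open>Commuting operators\<close> (\<open>pcomp_commute_up_to_sign\<close>). Once all arities from \<open>w\<close> on are good,
  changing the input \<open>i\<close> in \<open>x \<circ>\<^sub>i y\<close> amounts to permuting the inputs of the result, that is, to a
  sign if all transpositions act on \<open>x\<close> by the same sign. So parallel associativity says that the
  operators \<open>x \<mapsto> x \<circ>\<^sub>1 y\<close> commute up to sign, and the part of the operad in arities at least \<open>w\<close> is
  spanned by monomials in finitely many of them applied to finitely many vectors.

  \<^emph>\<open>Monomials.\<close> As in the theory of Groebner bases, the monomials that are not combinations of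
  lexicographically smaller ones of the same degree form a basis, and a divisor of such a normal
  monomial is normal. Subquadratic growth forbids two large exponents in one normal monomial
  (\<open>at_most_one_large_exponent\<close>), so normal monomials lie on finitely many rays. Lowering the
  large exponent embeds the normal monomials of degree \<open>n + p\<close> into those of degree \<open>n\<close> for a
  suitable period \<open>p\<close> (\<open>dim_antitone_along_period\<close>). So the dimensions are eventually periodic,
  whence the Hilbert series is rational with bounded coefficients. Right ideals are submodules,
  nested submodules with the same leading monomials agree, and on each ray the leading monomials of
  a submodule form an up-closed set of normal monomials
  (\<open>ascending_chain_condition\<close>).
\<close>

section \<open>Finitely spanned subspaces\<close>

context vector_space
begin

lemma card_le_dim_of_finitely_spanned:
  assumes "finite B" "span B = V" "independent A" "A \<subseteq> V"
  shows "finite A \<and> card A \<le> dim V"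
proof -
  obtain C where C: "C \<subseteq> V" "independent C" "V \<subseteq> span C" "card C = dim V"
    using basis_exists by metis
  have "finite C"
    using independent_span_bound[OF assms(1) C(2)] C(1) assms(2) by auto
  moreover have "A \<subseteq> span C" using assms(4) C(3) by blast
  ultimately show ?thesis
    using independent_span_bound[OF _ assms(3)] C(4) by metis
qed

lemma subspace_eq_of_dim_le:
  assumes "finite B" "span B = V" "subspace S" "S \<subseteq> T" "T \<subseteq> V" "dim T \<le> dim S"
  shows "S = T"
proof (rule ccontr)
  assume "S \<noteq> T"
  then obtain t where t: "t \<in> T" "t \<notin> S" using assms(4) by auto
  obtain C where C: "C \<subseteq> S" "independent C" "S \<subseteq> span C" "card C = dim S"
    using basis_exists by metis
  have SC: "span C = S" using C(1,3) assms(3) span_minimal by blast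
  have ind: "independent (insert t C)"
    using C(2) t(2) SC independent_insert by auto
  obtain D where D: "D \<subseteq> T" "independent D" "T \<subseteq> span D" "card D = dim T"
    using basis_exists by metis
  have fD: "finite D"
    using card_le_dim_of_finitely_spanned[OF assms(1,2) D(2)] D(1) assms(5) by auto
  have fC: "finite (insert t C) \<and> card (insert t C) \<le> card D"
  proof (rule independent_span_bound[OF fD ind])
    show "insert t C \<subseteq> span D" using D(3) t(1) C(1) assms(4) by blast
  qed
  moreover have "t \<notin> C" using t(2) C(1) by blast
  ultimately have "card C < card D" using fC by (simp add: card_insert_disjoint)
  then show False using C(4) D(4) assms(6) by simp
qed

lemma chain_of_subspaces_stabilises:
  assumes "finite B" "span B = V"
    and sub: "\<And>k. subspace (J k)" and JV: "\<And>k. J k \<subseteq> V" and inc: "\<And>k. J k \<subseteq> J (Suc k)"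
  shows "\<exists>K. \<forall>k\<ge>K. J k = J K"
proof -
  have mono: "J k \<subseteq> J l" if "k \<le> l" for k l using that inc by (rule lift_Suc_mono_le[rotated])
  have bound: "dim (J k) < Suc (dim V)" for k
  proof -
    obtain C where C: "C \<subseteq> J k" "independent C" "J k \<subseteq> span C" "card C = dim (J k)"
      using basis_exists by metis
    show ?thesis
      using card_le_dim_of_finitely_spanned[OF assms(1,2) C(2) order_trans[OF C(1) JV]] C(4) by simp
  qed
  obtain K where K: "\<forall>k. dim (J k) \<le> dim (J K)"
    using ex_has_greatest_nat[of "\<lambda>_. True" 0 "\<lambda>k. dim (J k)" "Suc (dim V)"] bound by blast
  have "J k = J K" if "k \<ge> K" for k
    using subspace_eq_of_dim_le[OF assms(1,2) sub[of K] mono[OF that] JV[of k]] K by auto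
  then show ?thesis by blast
qed

end

section \<open>Growth and rationality\<close>

text \<open>
  The lower bound lies below both \<open>\<Sum>k<K. (k - 1) / 4\<close> and \<open>K\<^sup>2\<close>, the two amounts of growth that occur.
\<close>
lemma quadratic_growth_contradiction:
  fixes S :: "nat \<Rightarrow> real"
  assumes growth: "\<forall>\<^sub>F n in sequentially. S n \<le> real n powr (3/2)"
    and "0 < B"
    and lower: "\<And>K::nat. (real K)^2 / 8 - real K \<le> S (A + B * K)"
  shows False
proof -
  define b where "b = real B"
  define a where "a = real A + 1"
  have b: "b > 0" "a > 0" using assms(2) by (simp_all add: a_def b_def)
  have lt: "\<forall>\<^sub>F K in sequentially. (a + b * real K) powr (3/2) < (real K)^2 / 8 - real K"
    using b by real_asymp
  have "filterlim (\<lambda>K. A + B * K) sequentially sequentially"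
    by (rule filterlim_subseq) (use assms(2) in \<open>auto simp: strict_mono_def\<close>)
  from eventually_compose_filterlim[OF growth this] lt
  have "\<forall>\<^sub>F K::nat in sequentially. False"
  proof eventually_elim
    case (elim K)
    have "real (A + B * K) powr (3/2) \<le> (a + b * real K) powr (3/2)"
      using b by (intro powr_mono2) (auto simp: a_def b_def)
    then show ?case using elim lower[of K] by linarith
  qed
  then show False by simp
qed

text \<open>
  A sequence of natural numbers that does not increase along steps of length \<open>p\<close> is bounded and
  eventually has period \<open>p\<close>, so that multiplication of its generating function by \<open>1 - X ^ p\<close> leaves
  a polynomial.
\<close>
lemma eventually_antitone_steps:
  fixes h :: "nat \<Rightarrow> nat"
  assumes "0 < p" and step: "\<And>n. n \<ge> n1 \<Longrightarrow> h (n + p) \<le> h n"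
  shows "\<exists>N. \<forall>n. h n \<le> N"
    and "rational_fps (Abs_fps (\<lambda>n. of_nat (h n)) :: 'c::field fps)"
proof -
  have "h n \<le> Max (h ` {..n1 + p})" for n
  proof (induction n rule: less_induct)
    case (less n)
    show ?case
    proof (cases "n \<le> n1 + p")
      case False
      then have "h n \<le> h (n - p)" using step[of "n - p"] by simp
      also have "\<dots> \<le> Max (h ` {..n1 + p})" using less[of "n - p"] False assms(1) by simp
      finally show ?thesis .
    qed simp
  qed
  then show "\<exists>N. \<forall>n. h n \<le> N" by blast
next
  (* The sums over windows of length p decrease to their minimum; from there on no step can be strict. *)
  define W where "W n = (\<Sum>i<p. h (n + i))" for n
  have WSuc: "W (Suc n) + h n = W n + h (n + p)" for n
  proof -
    have "W (Suc n) + h n = (\<Sum>i<Suc p. h (n + i))"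
      unfolding W_def by (subst sum.lessThan_Suc_shift) simp
    then show ?thesis by (simp add: W_def)
  qed
  obtain n2 where n2: "n2 \<ge> n1" "\<And>n. n \<ge> n1 \<Longrightarrow> W n2 \<le> W n"
    using ex_has_least_nat[of "\<lambda>n. n \<ge> n1" n1 W] by auto
  have W2: "W n = W n2" if "n \<ge> n2" for n
    using that
  proof (induction n rule: dec_induct)
    case (step n)
    have "W (Suc n) \<le> W n" using WSuc[of n] assms(2)[of n] step(1) n2(1) by simp
    then show ?case using n2(2)[of "Suc n"] n2(1) step by simp
  qed simp
  have per: "h (n + p) = h n" if "n \<ge> n2" for n
    using WSuc[of n] W2[of n] W2[of "Suc n"] that by simp
  define F :: "'c fps" where "F = Abs_fps (\<lambda>n. of_nat (h n))"
  define Q :: "'c poly" where "Q = 1 - monom 1 p"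
  have FQ: "fps_nth (F * fps_of_poly Q) n = of_nat (h n) - (if n < p then 0 else of_nat (h (n - p)))" for n
    by (simp add: Q_def F_def fps_of_poly_diff fps_of_poly_monom right_diff_distrib fps_X_power_mult_right_nth)
  have "coeff Q 0 = 1" using assms(1) by (simp add: Q_def)
  then have "Q \<noteq> 0" by auto
  moreover have "F * fps_of_poly Q = fps_of_poly (\<Sum>i<n2 + p. monom (fps_nth (F * fps_of_poly Q) i) i)"
  proof (rule fps_ext)
    fix n
    show "fps_nth (F * fps_of_poly Q) n = fps_nth (fps_of_poly (\<Sum>i<n2 + p. monom (fps_nth (F * fps_of_poly Q) i) i)) n"
    proof (cases "n < n2 + p")
      case True
      then show ?thesis by (simp add: coeff_sum if_distrib sum.delta cong: if_cong)
    next
      case False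
      then have "fps_nth (F * fps_of_poly Q) n = 0" unfolding FQ using per[of "n - p"] by simp
      then show ?thesis using False by (simp add: coeff_sum if_distrib sum.delta cong: if_cong)
    qed
  qed
  ultimately show "rational_fps (Abs_fps (\<lambda>n. of_nat (h n)) :: 'c fps)"
    unfolding rational_fps_def F_def by blast
qed

section \<open>Monomials\<close>

text \<open>
  A monomial is a function \<open>f\<close>: its value at \<open>0\<close> is the index of one of \<open>q\<close> module generators, and
  \<open>f a\<close> for \<open>1 \<le> a \<le> r\<close> is the exponent of the \<open>a\<close>-th operator. Keeping the generator in the same
  function as the exponents makes one lexicographic order serve for both.
\<close>
definition exponents :: "nat \<Rightarrow> nat \<Rightarrow> (nat \<Rightarrow> nat) set" where
  "exponents q r = {f. f 0 < q \<and> (\<forall>i>r. f i = 0)}"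

text \<open>
  The degree of a monomial, if the \<open>j\<close>-th generator has degree \<open>c j\<close> and the \<open>a\<close>-th operator raises
  degrees by \<open>d a\<close>.
\<close>
definition weight :: "(nat \<Rightarrow> nat) \<Rightarrow> (nat \<Rightarrow> nat) \<Rightarrow> nat \<Rightarrow> (nat \<Rightarrow> nat) \<Rightarrow> nat" where
  "weight c d r f = c (f 0) + (\<Sum>a\<in>{1..r}. d a * f a)"

definition lex_less :: "(nat \<Rightarrow> nat) \<Rightarrow> (nat \<Rightarrow> nat) \<Rightarrow> bool" where
  "lex_less f g \<longleftrightarrow> (\<exists>a. f a < g a \<and> (\<forall>b<a. f b = g b))"

lemma lex_less_linear: "f \<noteq> g \<Longrightarrow> lex_less f g \<or> lex_less g f"
proof -
  assume "f \<noteq> g"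
  then have ex: "\<exists>a. f a \<noteq> g a" by auto
  define a where "a = (LEAST a. f a \<noteq> g a)"
  have "f a \<noteq> g a" unfolding a_def using ex by (rule LeastI_ex)
  moreover have "\<forall>b<a. f b = g b" unfolding a_def using not_less_Least by blast
  ultimately show ?thesis unfolding lex_less_def by (metis nat_neq_iff)
qed

lemma lex_less_irrefl: "\<not> lex_less f f"
  by (simp add: lex_less_def)

lemma lex_less_trans: "lex_less f g \<Longrightarrow> lex_less g h \<Longrightarrow> lex_less f h"
  unfolding lex_less_def
proof (elim exE conjE)
  fix a b assume *: "f a < g a" "\<forall>b<a. f b = g b" "g b < h b" "\<forall>c<b. g c = h c"
  consider "a < b" | "a = b" | "b < a" by linarith
  then show "\<exists>a. f a < h a \<and> (\<forall>b<a. f b = h b)"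
  proof cases
    case 1
    then have "f a < h a" "\<forall>c<a. f c = h c" using * by auto
    then show ?thesis by blast
  next
    case 2
    then have "f a < h a" "\<forall>c<a. f c = h c" using * by auto
    then show ?thesis by blast
  next
    case 3
    then have "f b < h b" "\<forall>c<b. f c = h c" using * by auto
    then show ?thesis by blast
  qed
qed

lemma lex_less_Suc: "lex_less f g \<Longrightarrow> lex_less (f(a := Suc (f a))) (g(a := Suc (g a)))"
  unfolding lex_less_def by auto

lemma lex_max_exists:
  assumes "finite F" "F \<noteq> {}"
  shows "\<exists>m\<in>F. \<forall>g\<in>F. g \<noteq> m \<longrightarrow> lex_less g m"
  using assms
proof (induction rule: finite_ne_induct)
  case (insert x F)
  then obtain m where m: "m \<in> F" "\<forall>g\<in>F. g \<noteq> m \<longrightarrow> lex_less g m" by auto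
  show ?case
  proof (cases "lex_less x m")
    case True
    then show ?thesis using m by auto
  next
    case False
    then have "x = m \<or> lex_less m x" using lex_less_linear by blast
    then show ?thesis using m by (metis insert_iff lex_less_trans)
  qed
qed simp

lemma weight_upd:
  assumes "a \<in> {1..r}"
  shows "weight c d r (f(a := k)) + d a * f a = weight c d r f + d a * k"
proof -
  have "(\<Sum>b\<in>{1..r}. d b * (f(a := k)) b) = d a * k + (\<Sum>b\<in>{1..r}-{a}. d b * f b)"
    using assms by (subst sum.remove[of _ a]) (auto intro!: sum.cong)
  moreover have "(\<Sum>b\<in>{1..r}. d b * f b) = d a * f a + (\<Sum>b\<in>{1..r}-{a}. d b * f b)"
    using assms by (subst sum.remove[of _ a]) auto
  ultimately show ?thesis using assms by (simp add: weight_def)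
qed

lemma weight_Suc: "a \<in> {1..r} \<Longrightarrow> weight c d r (f(a := Suc (f a))) = weight c d r f + d a"
  using weight_upd[of a r c d f "Suc (f a)"] by simp

lemma exponents_upd: "f \<in> exponents q r \<Longrightarrow> a \<in> {1..r} \<Longrightarrow> f(a := k) \<in> exponents q r"
  by (auto simp: exponents_def)

lemma finite_exponents_bounded: "finite {f \<in> exponents q r. \<forall>a\<in>{1..r}. f a \<le> n}"
proof (rule finite_subset)
  show "finite {f :: nat \<Rightarrow> nat. \<forall>x. (x \<in> {..r} \<longrightarrow> f x \<in> {..max q n}) \<and> (x \<notin> {..r} \<longrightarrow> f x = 0)}"
    by (rule finite_set_of_finite_funs) auto
  show "{f \<in> exponents q r. \<forall>a\<in>{1..r}. f a \<le> n}
      \<subseteq> {f. \<forall>x. (x \<in> {..r} \<longrightarrow> f x \<in> {..max q n}) \<and> (x \<notin> {..r} \<longrightarrow> f x = 0)}"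
  proof
    fix f assume f: "f \<in> {f \<in> exponents q r. \<forall>a\<in>{1..r}. f a \<le> n}"
    have "f x \<le> max q n" if "x \<le> r" for x
      using f that by (cases "x = 0") (auto simp: exponents_def le_max_iff_disj)
    then show "f \<in> {f. \<forall>x. (x \<in> {..r} \<longrightarrow> f x \<in> {..max q n}) \<and> (x \<notin> {..r} \<longrightarrow> f x = 0)}"
      using f by (auto simp: exponents_def)
  qed
qed

section \<open>Graded modules spanned by monomials\<close>

text \<open>
  A graded module, given by subspaces \<open>M n\<close> of one ambient space and operators \<open>R a n\<close> from \<open>M n\<close> to
  \<open>M (n + d a)\<close>, which from degree \<open>w\<close> on is spanned by vectors \<open>mon f\<close> that the operators map to
  one another, up to sign, as they would map monomials. Signs are invisible to spans, so the theory of
  initial ideals of polynomial rings applies.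
\<close>
locale monomial_module = vector_space scale
  for scale :: "'k::field \<Rightarrow> 'a::ab_group_add \<Rightarrow> 'a" +
  fixes M :: "nat \<Rightarrow> 'a set"
    and R :: "nat \<Rightarrow> nat \<Rightarrow> 'a \<Rightarrow> 'a"
    and c d :: "nat \<Rightarrow> nat" and q r w :: nat
    and mon :: "(nat \<Rightarrow> nat) \<Rightarrow> 'a"
  assumes r_pos: "0 < r"
    and d_pos: "a \<in> {1..r} \<Longrightarrow> 0 < d a"
    and subspace_M: "subspace (M n)"
    and finite_M: "\<exists>B. finite B \<and> B \<subseteq> M n \<and> span B = M n"
    and R_closed: "a \<in> {1..r} \<Longrightarrow> x \<in> M n \<Longrightarrow> R a n x \<in> M (n + d a)"
    and R_add: "a \<in> {1..r} \<Longrightarrow> x \<in> M n \<Longrightarrow> y \<in> M n \<Longrightarrow> R a n (x + y) = R a n x + R a n y"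
    and R_scale: "a \<in> {1..r} \<Longrightarrow> x \<in> M n \<Longrightarrow> R a n (scale k x) = scale k (R a n x)"
    and mon_in: "f \<in> exponents q r \<Longrightarrow> mon f \<in> M (weight c d r f)"
    and R_mon: "f \<in> exponents q r \<Longrightarrow> a \<in> {1..r} \<Longrightarrow>
        R a (weight c d r f) (mon f) = mon (f(a := Suc (f a))) \<or>
        R a (weight c d r f) (mon f) = - mon (f(a := Suc (f a)))"
    and M_span: "w \<le> n \<Longrightarrow> M n \<subseteq> span (mon ` {f \<in> exponents q r. weight c d r f = n})"
    and growth: "\<forall>\<^sub>F n in sequentially. real (\<Sum>i\<le>n. dim (M i)) \<le> real n powr (3/2)"
begin

abbreviation E where "E \<equiv> exponents q r"
abbreviation wt where "wt \<equiv> weight c d r"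

definition lower :: "(nat \<Rightarrow> nat) \<Rightarrow> 'a set" where
  "lower f = span (mon ` {g \<in> E. wt g = wt f \<and> lex_less g f})"

text \<open>These are the monomials that are not leading monomials of linear relations.\<close>
definition normal :: "(nat \<Rightarrow> nat) set" where
  "normal = {f \<in> E. mon f \<notin> lower f}"

lemma mon_in_weight: "f \<in> E \<Longrightarrow> wt f = n \<Longrightarrow> mon f \<in> M n"
  using mon_in by blast

lemma exponent_le_weight: "a \<in> {1..r} \<Longrightarrow> f a \<le> wt f"
proof -
  assume a: "a \<in> {1..r}"
  have "f a \<le> d a * f a" using d_pos[OF a] by simp
  also have "\<dots> \<le> (\<Sum>b\<in>{1..r}. d b * f b)" using a by (intro member_le_sum) auto
  finally show ?thesis by (simp add: weight_def)
qed

lemma finite_weight_le: "finite {f \<in> E. wt f \<le> n}"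
  by (rule finite_subset[OF _ finite_exponents_bounded[of q r n]])
     (auto dest: exponent_le_weight intro: order_trans[OF exponent_le_weight])

lemma finite_weight: "finite {f \<in> E. wt f = n}"
  by (rule finite_subset[OF _ finite_weight_le[of n]]) auto

text \<open>
  The lexicographic order is well-founded here since each degree contains only finitely many
  monomials.
\<close>
lemma lex_induct [consumes 1, case_names less]:
  assumes "f \<in> E"
    and "\<And>f. f \<in> E \<Longrightarrow> (\<And>g. g \<in> E \<Longrightarrow> wt g = wt f \<Longrightarrow> lex_less g f \<Longrightarrow> Q g) \<Longrightarrow> Q f"
  shows "Q f"
  using assms(1)
proof (induction "card {g \<in> E. wt g = wt f \<and> lex_less g f}" arbitrary: f rule: less_induct)
  case less
  show ?case
  proof (rule assms(2)[OF less(2)])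
    fix g assume g: "g \<in> E" "wt g = wt f" "lex_less g f"
    have "{h \<in> E. wt h = wt g \<and> lex_less h g} \<subset> {h \<in> E. wt h = wt f \<and> lex_less h f}"
      using g lex_less_trans[of _ g f] lex_less_irrefl[of g] by auto
    moreover have "finite {h \<in> E. wt h = wt f \<and> lex_less h f}"
      by (rule finite_subset[OF _ finite_weight[of "wt f"]]) auto
    ultimately show "Q g" by (intro less(1) g(1) psubset_card_mono)
  qed
qed

lemma mon_in_normal_span: "f \<in> E \<Longrightarrow> mon f \<in> span (mon ` {g \<in> normal. wt g = wt f})"
proof (induction f rule: lex_induct)
  case (less f)
  show ?case
  proof (cases "f \<in> normal")
    case True
    then show ?thesis by (intro span_base) auto
  next
    case False
    then have "mon f \<in> lower f" using less(1) by (simp add: normal_def)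
    moreover have "lower f \<subseteq> span (mon ` {g \<in> normal. wt g = wt f})"
      unfolding lower_def by (rule span_minimal) (use less(2) in auto)
    ultimately show ?thesis by blast
  qed
qed

lemma normal_subset: "normal \<subseteq> E" by (auto simp: normal_def)

lemma normal_independent:
  assumes "finite F" "F \<subseteq> normal" "\<And>f. f \<in> F \<Longrightarrow> wt f = n"
  shows "independent (mon ` F) \<and> inj_on mon F"
  using assms
proof (induction "card F" arbitrary: F)
  case (Suc k)
  then have "F \<noteq> {}" by auto
  then obtain m where m: "m \<in> F" "\<forall>g\<in>F. g \<noteq> m \<longrightarrow> lex_less g m"
    using lex_max_exists Suc(3) by blast
  have IH: "independent (mon ` (F - {m})) \<and> inj_on mon (F - {m})"
    using Suc m(1) by (intro Suc(1)) auto
  have "span (mon ` (F - {m})) \<subseteq> lower m"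
    unfolding lower_def using m Suc(4,5) normal_subset by (intro span_mono image_mono) blast
  moreover have "mon m \<notin> lower m" using m(1) Suc(4) by (auto simp: normal_def)
  ultimately have nin: "mon m \<notin> span (mon ` (F - {m}))" by blast
  then have "independent (insert (mon m) (mon ` (F - {m})))"
    using IH independent_insert by auto
  moreover have "mon ` F = insert (mon m) (mon ` (F - {m}))" using m(1) by auto
  moreover have "inj_on mon (insert m (F - {m}))"
    unfolding inj_on_insert using IH nin span_base[of "mon m" "mon ` (F - {m})"] by auto
  moreover have "insert m (F - {m}) = F" using m(1) by auto
  ultimately show ?case by simp
qed (simp add: independent_empty)

lemma finite_normal_weight: "finite {f \<in> normal. wt f = n}"
  by (rule finite_subset[OF _ finite_weight[of n]]) (use normal_subset in auto)

lemma card_normal_le_dim: "card {f \<in> normal. wt f = n} \<le> dim (M n)"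
proof -
  obtain B where B: "finite B" "B \<subseteq> M n" "span B = M n" using finite_M by metis
  have *: "independent (mon ` {f \<in> normal. wt f = n}) \<and> inj_on mon {f \<in> normal. wt f = n}"
    by (rule normal_independent[OF finite_normal_weight]) auto
  have "mon ` {f \<in> normal. wt f = n} \<subseteq> M n" using mon_in normal_subset by auto
  then have "card (mon ` {f \<in> normal. wt f = n}) \<le> dim (M n)"
    using card_le_dim_of_finitely_spanned[OF B(1,3)] * by simp
  then show ?thesis using * by (simp add: card_image)
qed

lemma dim_eq_card_normal: "w \<le> n \<Longrightarrow> dim (M n) = card {f \<in> normal. wt f = n}"
proof (rule antisym[OF _ card_normal_le_dim])
  assume "w \<le> n"
  have "mon ` {f \<in> E. wt f = n} \<subseteq> span (mon ` {f \<in> normal. wt f = n})"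
    using mon_in_normal_span by auto
  then have "M n \<subseteq> span (mon ` {f \<in> normal. wt f = n})"
    using M_span[OF \<open>w \<le> n\<close>] span_minimal subspace_span by blast
  then have "dim (M n) \<le> card (mon ` {f \<in> normal. wt f = n})"
    by (rule dim_le_card) (simp add: finite_normal_weight)
  also have "\<dots> \<le> card {f \<in> normal. wt f = n}"
    by (rule card_image_le[OF finite_normal_weight])
  finally show "dim (M n) \<le> card {f \<in> normal. wt f = n}" .
qed

lemma R_zero: "a \<in> {1..r} \<Longrightarrow> R a n 0 = 0"
proof -
  assume a: "a \<in> {1..r}"
  have "R a n (scale 0 0) = scale 0 (R a n 0)"
    by (rule R_scale[OF a subspace_0[OF subspace_M]])
  then show ?thesis by simp
qed

lemma R_diff: "a \<in> {1..r} \<Longrightarrow> x \<in> M n \<Longrightarrow> y \<in> M n \<Longrightarrow> R a n (x - y) = R a n x - R a n y"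
proof -
  assume a: "a \<in> {1..r}" and x: "x \<in> M n" and y: "y \<in> M n"
  have "R a n (x + scale (- 1) y) = R a n x + R a n (scale (- 1) y)"
    by (rule R_add[OF a x subspace_scale[OF subspace_M y]])
  also have "R a n (scale (- 1) y) = scale (- 1) (R a n y)" by (rule R_scale[OF a y])
  finally show ?thesis by simp
qed

lemma R_span:
  assumes "a \<in> {1..r}" "subspace T" "S \<subseteq> M n" "\<And>x. x \<in> S \<Longrightarrow> R a n x \<in> T" "x \<in> span S"
  shows "R a n x \<in> T"
proof -
  have "subspace {x \<in> M n. R a n x \<in> T}"
  proof (rule subspaceI)
    show "0 \<in> {x \<in> M n. R a n x \<in> T}"
      using subspace_0[OF subspace_M] subspace_0[OF assms(2)] R_zero[OF assms(1)] by simp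
  qed (use subspace_add[OF subspace_M] subspace_add[OF assms(2)] R_add[OF assms(1)]
        subspace_scale[OF subspace_M] subspace_scale[OF assms(2)] R_scale[OF assms(1)] in simp_all)
  then have "span S \<subseteq> {x \<in> M n. R a n x \<in> T}" by (rule span_minimal[rotated]) (use assms in auto)
  then show ?thesis using assms(5) by auto
qed

lemma subspace_lower: "subspace (lower f)"
  by (simp add: lower_def)

text \<open>
  Multiplication by an operator preserves the order of monomials, so it maps combinations of smaller
  monomials to such combinations.
\<close>
lemma R_lower:
  assumes a: "a \<in> {1..r}" and x: "x \<in> lower f"
  shows "R a (wt f) x \<in> lower (f(a := Suc (f a)))"
proof (rule R_span[OF a subspace_lower])
  show "x \<in> span (mon ` {g \<in> E. wt g = wt f \<and> lex_less g f})" using x by (simp add: lower_def)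
  show "mon ` {g \<in> E. wt g = wt f \<and> lex_less g f} \<subseteq> M (wt f)" by (auto intro: mon_in_weight)
  fix y assume "y \<in> mon ` {g \<in> E. wt g = wt f \<and> lex_less g f}"
  then obtain g where g: "g \<in> E" "wt g = wt f" "lex_less g f" "y = mon g" by auto
  have "mon (g(a := Suc (g a))) \<in> lower (f(a := Suc (f a)))"
    unfolding lower_def
    by (intro span_base imageI) (use g a in \<open>auto simp: exponents_upd lex_less_Suc weight_Suc simp del: fun_upd_apply\<close>)
  then show "R a (wt f) y \<in> lower (f(a := Suc (f a)))"
    using R_mon[OF g(1) a] g(2,4) subspace_neg[OF subspace_lower] by auto
qed

text \<open>
  A relation with leading monomial \<open>f\<close> can be multiplied by an operator; hence divisors of normal
  monomials are normal.
\<close>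
lemma normal_pred:
  assumes "f(a := Suc (f a)) \<in> normal" "f \<in> E" "a \<in> {1..r}"
  shows "f \<in> normal"
proof (rule ccontr)
  assume "f \<notin> normal"
  then have "mon f \<in> lower f" using assms(2) by (simp add: normal_def)
  then have "R a (wt f) (mon f) \<in> lower (f(a := Suc (f a)))" using R_lower assms(3) by blast
  then have "mon (f(a := Suc (f a))) \<in> lower (f(a := Suc (f a)))"
    using R_mon[OF assms(2,3)] subspace_neg[OF subspace_lower] by fastforce
  then show False using assms(1) by (simp add: normal_def)
qed

lemma normal_antitone:
  assumes "g \<in> normal" "f 0 = g 0" "\<And>i. f i \<le> g i"
  shows "f \<in> normal"
  using assms(2,3)
proof (induction "\<Sum>i\<in>{1..r}. g i - f i" arbitrary: f rule: less_induct)
  case less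
  have gE: "g \<in> E" using assms(1) normal_subset by blast
  have g0: "g i = 0" if "i > r" for i using gE that by (auto simp: exponents_def)
  have fE: "f \<in> E" using gE less(2,3) by (auto simp: exponents_def) (metis le_zero_eq)
  show ?case
  proof (cases "f = g")
    case False
    then obtain a where a: "f a \<noteq> g a" by auto
    have "a \<noteq> 0" using a less(2) by metis
    moreover have "a \<le> r"
    proof (rule ccontr)
      assume "\<not> a \<le> r"
      then show False using g0[of a] a less(3)[of a] by auto
    qed
    ultimately have ar: "a \<in> {1..r}" by auto
    have lt: "f a < g a" using a less(3)[of a] by simp
    have "f(a := Suc (f a)) \<in> normal"
    proof (rule less(1))
      show "(\<Sum>i\<in>{1..r}. g i - (f(a := Suc (f a))) i) < (\<Sum>i\<in>{1..r}. g i - f i)"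
        by (rule sum_strict_mono_ex1) (use ar lt in auto)
    qed (use lt less(2,3) ar in auto)
    then show ?thesis using normal_pred fE ar by blast
  qed (use assms(1) in auto)
qed

lemma c_le: "f \<in> E \<Longrightarrow> c (f 0) \<le> (\<Sum>j<q. c j)"
  by (rule member_le_sum) (auto simp: exponents_def)

text \<open>
  If a normal monomial has two exponents \<open>\<ge> K\<close>, its divisors that involve only these two operators,
  with exponents \<open>< K\<close>, are \<open>K\<^sup>2\<close> normal monomials of degree \<open>O(K)\<close>. For all \<open>K\<close> this would
  give quadratic growth.
\<close>
lemma at_most_one_large_exponent:
  "\<exists>L>0. \<forall>f\<in>normal. \<forall>a\<in>{1..r}. \<forall>b\<in>{1..r}. a \<noteq> b \<longrightarrow> f a < L \<or> f b < L"
proof (rule ccontr)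
  assume contra: "\<not> ?thesis"
  define A where "A = (\<Sum>j<q. c j)"
  define B where "B = 2 * (\<Sum>a\<in>{1..r}. d a)"
  have dB: "d a \<le> (\<Sum>a\<in>{1..r}. d a)" if "a \<in> {1..r}" for a
    using that by (intro member_le_sum) auto
  have "0 < B" using dB[of 1] d_pos[of 1] r_pos by (simp add: B_def)
  have *: "K * K \<le> (\<Sum>i\<le>A + B * K. dim (M i))" for K
  proof (cases "K = 0")
    case False
    then have "\<not> (\<forall>f\<in>normal. \<forall>a\<in>{1..r}. \<forall>b\<in>{1..r}. a \<noteq> b \<longrightarrow> f a < K \<or> f b < K)"
      using contra by blast
    then have "\<exists>f\<in>normal. \<exists>a\<in>{1..r}. \<exists>b\<in>{1..r}. a \<noteq> b \<and> K \<le> f a \<and> K \<le> f b"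
      by (simp only: bex_simps ball_simps not_less de_Morgan_disj not_imp)
    then obtain f a b where f: "f \<in> normal" and ab: "a \<in> {1..r}" "b \<in> {1..r}" "a \<noteq> b"
      and K: "K \<le> f a" "K \<le> f b"
      by blast
    define h where "h = (\<lambda>(x, y). ((\<lambda>i. if i = 0 then f 0 else 0)(a := x, b := y)))"
    have hn: "h z \<in> {g \<in> normal. wt g \<le> A + B * K}" if z: "z \<in> {..<K} \<times> {..<K}" for z
    proof -
      obtain x y where xy: "z = (x, y)" "x < K" "y < K" using z by auto
      have n: "h z \<in> normal"
        by (rule normal_antitone[OF f]) (use xy K ab in \<open>auto simp: h_def\<close>)
      have "wt (h z) = c (f 0) + (\<Sum>i\<in>{1..r}. (if i = a then d a * x else 0) + (if i = b then d b * y else 0))"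
        unfolding weight_def using ab xy by (auto simp: h_def intro!: sum.cong)
      also have "\<dots> = c (f 0) + d a * x + d b * y"
        using ab by (simp add: sum.distrib sum.delta)
      also have "\<dots> \<le> A + (\<Sum>a\<in>{1..r}. d a) * K + (\<Sum>a\<in>{1..r}. d a) * K"
        using c_le f normal_subset dB ab xy by (intro add_mono mult_mono) (auto simp: A_def)
      finally show ?thesis using n by (simp add: B_def algebra_simps)
    qed
    have inj: "inj_on h ({..<K} \<times> {..<K})"
    proof (rule inj_onI)
      fix z z' assume e: "h z = h z'"
      obtain x y where z: "z = (x, y)" by force
      obtain x' y' where z': "z' = (x', y')" by force
      have "h z a = h z' a" "h z b = h z' b" using e by auto
      then show "z = z'" using ab(3) by (simp add: z z' h_def)
    qed
    have fin: "finite {g \<in> normal. wt g \<le> A + B * K}"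
      by (rule finite_subset[OF _ finite_weight_le]) (use normal_subset in auto)
    have "K * K = card ({..<K} \<times> {..<K})" by (simp add: card_cartesian_product)
    also have "\<dots> \<le> card {g \<in> normal. wt g \<le> A + B * K}"
      using hn by (intro card_inj_on_le[OF inj _ fin]) auto
    also have "{g \<in> normal. wt g \<le> A + B * K} = (\<Union>i\<in>{..A + B * K}. {g \<in> normal. wt g = i})" by auto
    also have "card \<dots> \<le> (\<Sum>i\<le>A + B * K. card {g \<in> normal. wt g = i})"
      by (rule card_UN_le) simp
    also have "\<dots> \<le> (\<Sum>i\<le>A + B * K. dim (M i))" by (intro sum_mono card_normal_le_dim)
    finally show ?thesis .
  qed simp
  have "(real K)^2 / 8 - real K \<le> real (\<Sum>i\<le>A + B * K. dim (M i))" for K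
  proof -
    have "(real K)^2 / 8 - real K \<le> (real K)^2" by (rule order_trans[of _ "(real K)^2 / 8"]) auto
    also have "\<dots> = real (K * K)" by (simp add: power2_eq_square)
    also have "\<dots> \<le> real (\<Sum>i\<le>A + B * K. dim (M i))" using *[of K] by (rule of_nat_mono)
    finally show ?thesis .
  qed
  with quadratic_growth_contradiction[OF growth \<open>0 < B\<close>] show False by blast
qed

text \<open>
  With \<open>p\<close> a common multiple of the degrees of the operators, the map that divides a normal monomial by
  the power of degree \<open>p\<close> of its dominant operator is injective in large degrees: the
  exponent stays large, so the quotient still reveals which operator was dominant.
\<close>
lemma dim_antitone_along_period:
  "\<exists>p>0. \<exists>n1. \<forall>n\<ge>n1. dim (M (n + p)) \<le> dim (M n)"
proof -
  obtain L where L: "0 < L"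
    "\<And>f a b. f \<in> normal \<Longrightarrow> a \<in> {1..r} \<Longrightarrow> b \<in> {1..r} \<Longrightarrow> a \<noteq> b \<Longrightarrow> f a < L \<or> f b < L"
    using at_most_one_large_exponent by blast
  define p where "p = (\<Prod>a\<in>{1..r}. d a)"
  have p: "0 < p" unfolding p_def using d_pos by (intro prod_pos) auto
  define e where "e a = p div d a" for a
  have de: "d a * e a = p" if "a \<in> {1..r}" for a
    unfolding e_def p_def using that by (intro dvd_mult_div_cancel dvd_prodI) auto
  have ep: "e a \<le> p" for a by (simp add: e_def)
  (* Beyond this degree a monomial must have an exponent that stays at least L after the division. *)
  define n1 where "n1 = w + Suc ((\<Sum>j<q. c j) + (\<Sum>a\<in>{1..r}. d a * (L + p)))"
  have ex: "\<exists>a\<in>{1..r}. L + p \<le> f a" if f: "f \<in> E" and "n1 \<le> wt f" for f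
  proof (rule ccontr)
    assume "\<not> ?thesis"
    then have "wt f \<le> (\<Sum>j<q. c j) + (\<Sum>a\<in>{1..r}. d a * (L + p))"
      unfolding weight_def using c_le[OF f]
      by (intro add_mono sum_mono mult_le_mono) (auto simp: not_le intro: less_imp_le)
    then show False using that(2) by (simp add: n1_def)
  qed
  define big where "big f = (SOME a. a \<in> {1..r} \<and> L + p \<le> f a)" for f
  have big: "big f \<in> {1..r}" "L + p \<le> f (big f)" if "f \<in> E" "n1 \<le> wt f" for f
  proof -
    have "\<exists>a. a \<in> {1..r} \<and> L + p \<le> f a" using ex[OF that] by blast
    from someI_ex[OF this] show "big f \<in> {1..r}" "L + p \<le> f (big f)"
      unfolding big_def by blast+
  qed
  define \<phi> where "\<phi> f = f(big f := f (big f) - e (big f))" for f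
  have "dim (M (n + p)) \<le> dim (M n)" if n: "n1 \<le> n" for n
  proof -
    have wn: "w \<le> n" using n by (simp add: n1_def)
    have img: "\<phi> f \<in> {f \<in> normal. wt f = n}" if "f \<in> {f \<in> normal. wt f = n + p}" for f
    proof -
      have f: "f \<in> normal" "wt f = n + p" "f \<in> E" using that normal_subset by auto
      have b: "big f \<in> {1..r}" "L + p \<le> f (big f)" using big[OF f(3)] f(2) n by auto
      have "\<phi> f \<in> normal"
        by (rule normal_antitone[OF f(1)]) (use b in \<open>auto simp: \<phi>_def\<close>)
      moreover have "wt (\<phi> f) + d (big f) * f (big f) = wt f + d (big f) * (f (big f) - e (big f))"
        unfolding \<phi>_def by (rule weight_upd[OF b(1)])
      moreover have "d (big f) * (f (big f) - e (big f)) + p = d (big f) * f (big f)"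
      proof -
        have "e (big f) \<le> f (big f)" using ep[of "big f"] b(2) by simp
        then have "d (big f) * e (big f) \<le> d (big f) * f (big f)" by (rule mult_le_mono2)
        then show ?thesis
          using de[OF b(1)] by (simp add: diff_mult_distrib2)
      qed
      ultimately show ?thesis using f(2) by auto
    qed
    have "inj_on \<phi> {f \<in> normal. wt f = n + p}"
    proof (rule inj_onI)
      fix f g assume fg: "f \<in> {f \<in> normal. wt f = n + p}" "g \<in> {f \<in> normal. wt f = n + p}"
        and eq: "\<phi> f = \<phi> g"
      have bf: "big f \<in> {1..r}" "L + p \<le> f (big f)" using big[of f] fg n normal_subset by auto
      have bg: "big g \<in> {1..r}" "L + p \<le> g (big g)" using big[of g] fg n normal_subset by auto
      have 1: "L \<le> \<phi> f (big f)" using bf(2) ep[of "big f"] by (simp add: \<phi>_def)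
      have "L \<le> \<phi> g (big g)" using bg(2) ep[of "big g"] by (simp add: \<phi>_def)
      then have 2: "L \<le> \<phi> f (big g)" using eq by simp
      have same: "big f = big g"
        using L(2)[of "\<phi> f" "big f" "big g"] img[OF fg(1)] bf bg 1 2 by force
      show "f = g"
      proof
        fix i
        have "\<phi> f i = \<phi> g i" using eq by simp
        then show "f i = g i"
          using same bf(2) bg(2) ep[of "big g"] by (auto simp: \<phi>_def split: if_splits)
      qed
    qed
    then have "card {f \<in> normal. wt f = n + p} \<le> card {f \<in> normal. wt f = n}"
      using img by (intro card_inj_on_le[OF _ _ finite_normal_weight]) auto
    then show ?thesis using dim_eq_card_normal wn by simp
  qed
  then show ?thesis using p by blast
qed

definition leading :: "(nat \<Rightarrow> 'a set) \<Rightarrow> (nat \<Rightarrow> nat) set" where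
  "leading J = {f \<in> normal. \<exists>x\<in>J (wt f). x - mon f \<in> lower f}"

lemma leading_Suc:
  assumes sub: "\<And>n. subspace (J n)" and JM: "\<And>n. J n \<subseteq> M n"
    and closed: "\<And>a n x. a \<in> {1..r} \<Longrightarrow> x \<in> J n \<Longrightarrow> R a n x \<in> J (n + d a)"
    and f: "f \<in> leading J" and a: "a \<in> {1..r}" and n: "f(a := Suc (f a)) \<in> normal"
  shows "f(a := Suc (f a)) \<in> leading J"
proof -
  let ?g = "f(a := Suc (f a))"
  have fE: "f \<in> E" using f normal_subset by (auto simp: leading_def)
  obtain x where x: "x \<in> J (wt f)" "x - mon f \<in> lower f" using f by (auto simp: leading_def)
  have Rx: "R a (wt f) x \<in> J (wt ?g)" using closed[OF a x(1)] weight_Suc[OF a] by simp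
  have "R a (wt f) (x - mon f) \<in> lower ?g" by (rule R_lower[OF a x(2)])
  then have *: "R a (wt f) x - R a (wt f) (mon f) \<in> lower ?g"
    using R_diff[OF a subsetD[OF JM x(1)] mon_in[OF fE]] by simp
  show ?thesis
    using R_mon[OF fE a]
  proof
    assume "R a (wt f) (mon f) = mon ?g"
    then show ?thesis using * Rx n unfolding leading_def by auto
  next
    assume "R a (wt f) (mon f) = - mon ?g"
    then have "- (- R a (wt f) x - mon ?g) \<in> lower ?g" using * by (simp add: algebra_simps)
    then have "- R a (wt f) x - mon ?g \<in> lower ?g" using subspace_neg[OF subspace_lower] minus_minus by metis
    moreover have "- R a (wt f) x \<in> J (wt ?g)" using Rx subspace_neg[OF sub] by blast
    ultimately show ?thesis using n unfolding leading_def by blast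
  qed
qed

text \<open>
  Reduction modulo \<open>I\<close>: an element of \<open>J\<close> has a leading monomial, which an element of \<open>I\<close> also has;
  subtracting a multiple of the latter leaves a combination of smaller monomials.
\<close>
lemma eq_of_leading_eq:
  assumes subI: "\<And>n. subspace (I n)" and subJ: "\<And>n. subspace (J n)"
    and IJ: "\<And>n. I n \<subseteq> J n" and JM: "\<And>n. J n \<subseteq> M n"
    and lead: "leading J \<subseteq> leading I" and n: "w \<le> n"
  shows "I n = J n"
proof
  show "I n \<subseteq> J n" by (rule IJ)
  (* Initial segments G of the monomials of degree n, by induction on their size. *)
  have main: "x \<in> I n" if "finite G" "G \<subseteq> {f \<in> E. wt f = n}"
    "\<And>f g. f \<in> G \<Longrightarrow> g \<in> E \<Longrightarrow> wt g = n \<Longrightarrow> lex_less g f \<Longrightarrow> g \<in> G"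
    "x \<in> J n" "x \<in> span (mon ` G)" for x G
    using that
  proof (induction "card G" arbitrary: G x)
    case 0
    then show ?case using subspace_0[OF subI] by simp
  next
    case (Suc k)
    then have "G \<noteq> {}" by auto
    then obtain m where m: "m \<in> G" "\<forall>g\<in>G. g \<noteq> m \<longrightarrow> lex_less g m"
      using lex_max_exists Suc(3) by blast
    have mE: "m \<in> E" "wt m = n" using m(1) Suc(4) by auto
    have G': "G - {m} = {g \<in> E. wt g = wt m \<and> lex_less g m}"
    proof (intro set_eqI iffI)
      fix g assume "g \<in> G - {m}"
      then show "g \<in> {g \<in> E. wt g = wt m \<and> lex_less g m}" using m(2) Suc(4) mE by auto
    next
      fix g assume g: "g \<in> {g \<in> E. wt g = wt m \<and> lex_less g m}"
      then have "g \<in> G" using Suc(5)[OF m(1), of g] mE by simp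
      then show "g \<in> G - {m}" using g lex_less_irrefl by auto
    qed
    have low: "span (mon ` (G - {m})) = lower m" by (simp add: lower_def G')
    have IH: "y \<in> I n" if "y \<in> J n" "y \<in> lower m" for y
    proof (rule Suc(1)[of "G - {m}"])
      show "k = card (G - {m})" using Suc(2,3) m(1) by simp
      show "g \<in> G - {m}" if "f \<in> G - {m}" "g \<in> E" "wt g = n" "lex_less g f" for f g
      proof -
        have "g \<in> G" using that Suc(5)[of f g] by simp
        moreover have "lex_less g m" using that(1,4) m(2) lex_less_trans[of g f m] by simp
        ultimately show ?thesis using lex_less_irrefl by auto
      qed
    qed (use that low Suc(3,4) in auto)
    have "mon ` G = insert (mon m) (mon ` (G - {m}))" using m(1) by auto
    then have "x \<in> span (insert (mon m) (mon ` (G - {m})))" using Suc(7) by simp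
    then obtain k where k: "x - scale k (mon m) \<in> lower m"
      unfolding span_breakdown_eq low by blast
    show ?case
    proof (cases "k = 0 \<or> mon m \<in> lower m")
      case True
      then have "scale k (mon m) \<in> lower m"
        using subspace_0[OF subspace_lower] subspace_scale[OF subspace_lower] by auto
      then have "x \<in> lower m" using k subspace_add[OF subspace_lower] by fastforce
      then show ?thesis using IH Suc(6) by blast
    next
      case False
      have "scale (inverse k) (x - scale k (mon m)) \<in> lower m"
        using k subspace_scale[OF subspace_lower] by blast
      then have "scale (inverse k) x - mon m \<in> lower m" using False by (simp add: scale_right_diff_distrib)
      moreover have "scale (inverse k) x \<in> J (wt m)" using Suc(6) mE subspace_scale[OF subJ] by blast
      ultimately have "m \<in> leading J" using False mE by (auto simp: leading_def normal_def)
      then obtain y where y: "y \<in> I n" "y - mon m \<in> lower m"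
        using lead mE by (auto simp: leading_def)
      have "(x - scale k (mon m)) - scale k (y - mon m) \<in> lower m"
        using k y(2) subspace_scale[OF subspace_lower] subspace_diff[OF subspace_lower] by blast
      then have "x - scale k y \<in> lower m" by (simp add: scale_right_diff_distrib)
      moreover have "x - scale k y \<in> J n"
        using Suc(6) y(1) IJ subspace_scale[OF subJ] subspace_diff[OF subJ] by blast
      ultimately have "x - scale k y \<in> I n" by (rule IH[rotated])
      then have "(x - scale k y) + scale k y \<in> I n"
        using y(1) subspace_scale[OF subI] subspace_add[OF subI] by blast
      then show ?thesis by simp
    qed
  qed
  show "J n \<subseteq> I n"
  proof
    fix x assume x: "x \<in> J n"
    then have "x \<in> span (mon ` {f \<in> E. wt f = n})" using JM M_span[OF n] by blast
    with x show "x \<in> I n" by (intro main[OF finite_weight[of n]]) auto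
  qed
qed

text \<open>
  Every normal monomial lies on one of finitely many rays, on which all exponents but one are fixed and
  at most \<open>L\<close>. The leading monomials of a submodule on a ray are determined by the least of them, and
  along a chain of submodules this least one can drop only finitely often.
\<close>
lemma ascending_chain_condition:
  assumes sub: "\<And>k n. subspace (I k n)" and IM: "\<And>k n. I k n \<subseteq> M n"
    and inc: "\<And>k n. I k n \<subseteq> I (Suc k) n"
    and closed: "\<And>k a n x. a \<in> {1..r} \<Longrightarrow> x \<in> I k n \<Longrightarrow> R a n x \<in> I k (n + d a)"
  shows "\<exists>K. \<forall>k\<ge>K. \<forall>n. I k n = I K n"
proof -
  have mono: "I k n \<subseteq> I l n" if "k \<le> l" for k l n
    using lift_Suc_mono_le[of "\<lambda>k. I k n", OF inc that] .
  obtain L where L: "0 < L"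
    "\<And>f a b. f \<in> normal \<Longrightarrow> a \<in> {1..r} \<Longrightarrow> b \<in> {1..r} \<Longrightarrow> a \<noteq> b \<Longrightarrow> f a < L \<or> f b < L"
    using at_most_one_large_exponent by blast
  have up: "\<beta>(a := t) \<in> leading (I k)"
    if "\<beta>(a := s) \<in> leading (I k)" "s \<le> t" "a \<in> {1..r}" "\<beta>(a := t) \<in> normal" for \<beta> a s t k
    using that(2,4)
  proof (induction t rule: dec_induct)
    case (step t)
    have *: "\<beta>(a := t) \<in> normal"
      by (rule normal_antitone[OF step(4)]) (use that(3) in auto)
    have eq: "(\<beta>(a := t))(a := Suc ((\<beta>(a := t)) a)) = \<beta>(a := Suc t)" by simp
    show ?case
      using leading_Suc[of "I k" "\<beta>(a := t)" a, OF sub IM closed step(3)[OF *] that(3)] step(4)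
      unfolding eq by blast
  qed (use that(1) in simp)
  have lmono: "leading (I k) \<subseteq> leading (I l)" if "k \<le> l" for k l
    using mono[OF that] unfolding leading_def by blast
  define rays where "rays = {1..r} \<times> {f \<in> E. \<forall>a\<in>{1..r}. f a \<le> L}"
  have fin: "finite rays" unfolding rays_def using finite_exponents_bounded by blast
  have "\<exists>k0. \<forall>k t. (snd \<rho>)(fst \<rho> := t) \<in> leading (I k) \<longrightarrow> (snd \<rho>)(fst \<rho> := t) \<in> leading (I k0)"
    if \<rho>: "\<rho> \<in> rays" for \<rho>
  proof -
    obtain a \<beta> where ab: "\<rho> = (a, \<beta>)" "a \<in> {1..r}" using \<rho> by (auto simp: rays_def)
    show ?thesis
    proof (cases "\<exists>t k. \<beta>(a := t) \<in> leading (I k)")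
      case True
      define t0 where "t0 = (LEAST t. \<exists>k. \<beta>(a := t) \<in> leading (I k))"
      have "\<exists>k. \<beta>(a := t0) \<in> leading (I k)" unfolding t0_def using True by (rule LeastI_ex)
      then obtain k0 where k0: "\<beta>(a := t0) \<in> leading (I k0)" by blast
      have "\<beta>(a := t) \<in> leading (I k0)" if "\<beta>(a := t) \<in> leading (I k)" for t k
      proof (rule up[OF k0 _ ab(2)])
        show "t0 \<le> t" unfolding t0_def by (rule Least_le) (use that in blast)
        show "\<beta>(a := t) \<in> normal" using that by (simp add: leading_def)
      qed
      then show ?thesis using ab(1) by auto
    qed (use ab in auto)
  qed
  then obtain k0 where k0: "\<And>\<rho> k t. \<rho> \<in> rays \<Longrightarrow> (snd \<rho>)(fst \<rho> := t) \<in> leading (I k) \<Longrightarrow>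
      (snd \<rho>)(fst \<rho> := t) \<in> leading (I (k0 \<rho>))" by metis
  define K where "K = Max (k0 ` rays)"
  have lead: "leading (I k) \<subseteq> leading (I K)" for k
  proof
    fix f assume f: "f \<in> leading (I k)"
    then have fn: "f \<in> normal" "f \<in> E" using normal_subset by (auto simp: leading_def)
    obtain a where a: "a \<in> {1..r}" "\<And>b. b \<in> {1..r} \<Longrightarrow> b \<noteq> a \<Longrightarrow> f b < L"
    proof (cases "\<exists>a\<in>{1..r}. L \<le> f a")
      case True
      then obtain a where "a \<in> {1..r}" "L \<le> f a" by blast
      then show ?thesis using that[of a] L(2)[OF fn(1), of a] by force
    next
      case False
      then show ?thesis using that[of 1] r_pos by force
    qed
    have \<rho>: "(a, f(a := 0)) \<in> rays"
      unfolding rays_def using a fn(2) by (auto simp: exponents_upd less_imp_le)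
    have "f \<in> leading (I (k0 (a, f(a := 0))))"
      using k0[OF \<rho>, of "f a" k] f by simp
    moreover have "k0 (a, f(a := 0)) \<le> K" unfolding K_def using fin \<rho> by simp
    ultimately show "f \<in> leading (I K)" using lmono by blast
  qed
  have high: "I k n = I K n" if "K \<le> k" "w \<le> n" for k n
    using eq_of_leading_eq[OF sub sub mono[OF that(1)] IM lead that(2)] by simp
  have "\<exists>K. \<forall>k\<ge>K. I k n = I K n" for n
  proof -
    obtain B where B: "finite B" "span B = M n" using finite_M by metis
    show ?thesis by (rule chain_of_subspaces_stabilises[OF B, of "\<lambda>k. I k n"]) (rule sub IM inc)+
  qed
  then obtain K' where K': "\<And>k n. K' n \<le> k \<Longrightarrow> I k n = I (K' n) n" by metis
  define N where "N = K + (\<Sum>n<w. K' n)"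
  have "I k n = I N n" if "N \<le> k" for k n
  proof (cases "w \<le> n")
    case True
    then show ?thesis using high[of k n] high[of N n] that by (simp add: N_def)
  next
    case False
    then have "K' n \<le> N" unfolding N_def using member_le_sum[of n "{..<w}" K'] by simp
    then show ?thesis using K'[of n k] K'[of n N] that by simp
  qed
  then show ?thesis by blast
qed

end

section \<open>Positions in a composite\<close>

lemma position_cases:
  assumes "1 \<le> i"
  obtains k where "k \<noteq> i" "j = outer_pos n i k" | t where "t \<in> {1..n}" "j = i + t - 1"
proof -
  consider "j < i" | "i \<le> j" "j < i + n" | "i + n \<le> j" by linarith
  then show ?thesis
  proof cases
    case 1
    then show ?thesis using that(1)[of j] by (simp add: outer_pos_def)
  next
    case 2
    then show ?thesis using that(2)[of "j - i + 1"] by simp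
  next
    case 3
    then show ?thesis using that(1)[of "j + 1 - n"] that(2)[of 1] assms
      by (cases "n = 0") (auto simp: outer_pos_def)
  qed
qed

lemma outer_pos_inj: "0 < n \<Longrightarrow> k \<noteq> i \<Longrightarrow> l \<noteq> i \<Longrightarrow> outer_pos n i k = outer_pos n i l \<longleftrightarrow> k = l"
  by (auto simp: outer_pos_def split: if_splits)

lemma outer_pos_in:
  "0 < n \<Longrightarrow> i \<in> {1..m} \<Longrightarrow> k \<noteq> i \<Longrightarrow> outer_pos n i k \<in> {1..m + n - 1} \<longleftrightarrow> k \<in> {1..m}"
  by (auto simp: outer_pos_def split: if_splits)

lemma outer_pos_notin_block: "0 < n \<Longrightarrow> k \<noteq> i \<Longrightarrow> outer_pos n i k \<notin> {i..<i + n}"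
  by (auto simp: outer_pos_def)

lemma block_perm_outer:
  "0 < n \<Longrightarrow> k \<noteq> i \<Longrightarrow> block_perm n i \<sigma> \<tau> (outer_pos n i k) = outer_pos n (\<sigma> i) (\<sigma> k)"
  by (auto simp: outer_pos_def block_perm_def)

lemma block_perm_inner:
  "t \<in> {1..n} \<Longrightarrow> 1 \<le> i \<Longrightarrow> block_perm n i \<sigma> \<tau> (i + t - 1) = \<sigma> i + \<tau> t - 1"
  by (auto simp: block_perm_def)

lemma block_perm_permutes:
  assumes i: "i \<in> {1..m}" and \<sigma>: "\<sigma> permutes {1..m}" and \<tau>: "\<tau> permutes {1..n}" and n: "0 < n"
  shows "block_perm n i \<sigma> \<tau> permutes {1..m + n - 1}"
proof (rule bij_imp_permutes)
  let ?f = "block_perm n i \<sigma> \<tau>" and ?S = "{1..m + n - 1}"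
  have si: "\<sigma> i \<in> {1..m}" using \<sigma> i by (simp only: permutes_in_image)
  have surj: "?S \<subseteq> ?f ` ?S"
  proof
    fix j assume j: "j \<in> ?S"
    have "1 \<le> \<sigma> i" using si by simp
    then show "j \<in> ?f ` ?S"
    proof (cases rule: position_cases[of "\<sigma> i" j n])
      case (1 k)
      obtain k' where k': "k = \<sigma> k'" using permutes_surj[OF \<sigma>] by (metis surjD)
      have ne: "k' \<noteq> i" using 1 k' by auto
      have "k \<in> {1..m}" using outer_pos_in[OF n si 1(1)] j 1(2) by simp
      then have "k' \<in> {1..m}" using k' permutes_in_image[OF \<sigma>] by simp
      then have "outer_pos n i k' \<in> ?S" using outer_pos_in[OF n i ne] by simp
      moreover have "j = ?f (outer_pos n i k')" using block_perm_outer[OF n ne] 1(2) k' by simp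
      ultimately show ?thesis by blast
    next
      case (2 t)
      obtain t' where t': "t = \<tau> t'" using permutes_surj[OF \<tau>] by (metis surjD)
      have tn: "t' \<in> {1..n}" using 2(1) t' permutes_in_image[OF \<tau>] by simp
      have "j = ?f (i + t' - 1)" using block_perm_inner[OF tn] i 2(2) t' by simp
      moreover have "i + t' - 1 \<in> ?S" using i tn by auto
      ultimately show ?thesis by blast
    qed
  qed
  have "card (?f ` ?S) \<le> card ?S" by (rule card_image_le) simp
  then have eq: "?f ` ?S = ?S" using card_seteq[of "?f ` ?S" ?S] surj by simp
  then show "bij_betw ?f ?S ?S"
    unfolding bij_betw_def using eq_card_imp_inj_on[of ?S ?f] by simp
  fix j assume j: "j \<notin> ?S"
  have "1 \<le> i" using i by simp
  then show "?f j = j"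
  proof (cases rule: position_cases[of i j n])
    case (1 k)
    then have "k \<notin> {1..m}" using outer_pos_in[OF n i 1(1)] j by simp
    then have "\<sigma> k = k" by (rule permutes_not_in[OF \<sigma>])
    then show ?thesis
      using block_perm_outer[OF n 1(1)] 1(2) \<open>k \<notin> {1..m}\<close> i si by (auto simp: outer_pos_def)
  next
    case (2 t)
    then show ?thesis using i j by auto
  qed
qed

lemma block_perm_transpose:
  assumes n: "0 < n" and i: "1 \<le> i" and p: "p \<noteq> i" and q: "q \<noteq> i"
  shows "block_perm n i (transpose p q) id = transpose (outer_pos n i p) (outer_pos n i q)"
proof
  fix j
  have ti: "transpose p q i = i" using p q by simp
  show "block_perm n i (transpose p q) id j = transpose (outer_pos n i p) (outer_pos n i q) j"
    using i
  proof (cases rule: position_cases[of i j n])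
    case (1 k)
    consider "k = p" | "k = q" | "k \<noteq> p" "k \<noteq> q" by blast
    then show ?thesis
      using block_perm_outer[OF n 1(1), of "transpose p q" id] 1(2) ti
        outer_pos_inj[OF n 1(1) p] outer_pos_inj[OF n 1(1) q]
      by cases auto
  next
    case (2 t)
    have "j \<in> {i..<i + n}" using 2 i by auto
    then have "j \<noteq> outer_pos n i p" "j \<noteq> outer_pos n i q"
      using outer_pos_notin_block[OF n p] outer_pos_notin_block[OF n q] by auto
    then show ?thesis using block_perm_inner[OF 2(1) i, of "transpose p q" id] 2(2) ti by simp
  qed
qed

lemma two_further_points:
  assumes "finite A" "finite (F :: nat set)" "card F + 2 \<le> card A"
  obtains a b where "a \<in> A - F" "b \<in> A - F" "a \<noteq> b"
proof -
  have "card A - card F \<le> card (A - F)" by (rule diff_card_le_card_Diff[OF assms(2)])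
  then have c: "2 \<le> card (A - F)" using assms(3) by simp
  then obtain a where a: "a \<in> A - F" by (metis card.empty ex_in_conv not_numeral_le_zero)
  have "card (A - F - {a}) \<noteq> 0" using c a assms(1) by simp
  then obtain b where "b \<in> A - F - {a}" by (metis card.empty ex_in_conv)
  then show ?thesis using that[of a b] a by blast
qed

section \<open>Vectors fixed by the alternating group\<close>

definition transpositions :: "nat \<Rightarrow> (nat \<Rightarrow> nat) set" where
  "transpositions n = {transpose p q |p q. p \<in> {1..n} \<and> q \<in> {1..n} \<and> p \<noteq> q}"

lemma transpositionsI: "p \<in> {1..n} \<Longrightarrow> q \<in> {1..n} \<Longrightarrow> p \<noteq> q \<Longrightarrow> transpose p q \<in> transpositions n"
  unfolding transpositions_def by blast

lemma transpositions_permute: "t \<in> transpositions n \<Longrightarrow> t permutes {1..n}"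
  by (auto simp: transpositions_def intro!: permutes_swap_id)

lemma conj_transpose: "inj \<pi> \<Longrightarrow> \<pi> \<circ> transpose p q = transpose (\<pi> p) (\<pi> q) \<circ> \<pi>"
  by (auto simp: fun_eq_iff transpose_def inj_eq)

context symmetric_operad
begin

text \<open>
  This is the space of vectors fixed by the alternating group, which is generated by the products of
  two transpositions. Comparing transpositions avoids all reference to the parity of a permutation.
\<close>
definition alt_fixed :: "nat \<Rightarrow> 'a set" where
  "alt_fixed n = {x \<in> P n. \<forall>t\<in>transpositions n. \<forall>t'\<in>transpositions n. act n x t = act n x t'}"

lemma act_zero: "\<sigma> permutes {1..n} \<Longrightarrow> act n 0 \<sigma> = 0"
  using act_scale[of \<sigma> n 0 0] subspace_0[OF subspace_P] by simp

lemma act_diff: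
  assumes "\<sigma> permutes {1..n}" "x \<in> P n" "y \<in> P n"
  shows "act n (x - y) \<sigma> = act n x \<sigma> - act n y \<sigma>"
proof -
  have "act n (x + scale (- 1) y) \<sigma> = act n x \<sigma> + act n (scale (- 1) y) \<sigma>"
    by (rule act_add[OF assms(1,2) subspace_scale[OF subspace_P assms(3)]])
  also have "act n (scale (- 1) y) \<sigma> = scale (- 1) (act n y \<sigma>)" by (rule act_scale[OF assms(1,3)])
  finally show ?thesis by simp
qed

lemma pcomp_zero_left: "i \<in> {1..m} \<Longrightarrow> y \<in> P n \<Longrightarrow> pcomp m n i 0 y = 0"
  using pcomp_scale_left[of i m 0 y n 0] subspace_0[OF subspace_P] by simp

lemma pcomp_zero_right: "i \<in> {1..m} \<Longrightarrow> x \<in> P m \<Longrightarrow> pcomp m n i x 0 = 0"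
  using pcomp_scale_right[of i m x 0 n 0] subspace_0[OF subspace_P] by simp

lemma act_span:
  assumes "\<sigma> permutes {1..n}" "subspace T" "S \<subseteq> P n" "\<And>x. x \<in> S \<Longrightarrow> act n x \<sigma> \<in> T" "x \<in> span S"
  shows "act n x \<sigma> \<in> T"
proof -
  have "subspace {x \<in> P n. act n x \<sigma> \<in> T}"
  proof (rule subspaceI)
    show "0 \<in> {x \<in> P n. act n x \<sigma> \<in> T}"
      using subspace_0[OF subspace_P] subspace_0[OF assms(2)] act_zero[OF assms(1)] by simp
  qed (use subspace_add[OF subspace_P] subspace_add[OF assms(2)] act_add[OF assms(1)]
        subspace_scale[OF subspace_P] subspace_scale[OF assms(2)] act_scale[OF assms(1)] in simp_all)
  then have "span S \<subseteq> {x \<in> P n. act n x \<sigma> \<in> T}" by (rule span_minimal[rotated]) (use assms in auto)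
  then show ?thesis using assms(5) by auto
qed

lemma pcomp_span_left:
  assumes "i \<in> {1..m}" "y \<in> P n" "subspace T" "S \<subseteq> P m"
    "\<And>x. x \<in> S \<Longrightarrow> pcomp m n i x y \<in> T" "x \<in> span S"
  shows "pcomp m n i x y \<in> T"
proof -
  have "subspace {x \<in> P m. pcomp m n i x y \<in> T}"
  proof (rule subspaceI)
    show "0 \<in> {x \<in> P m. pcomp m n i x y \<in> T}"
      using subspace_0[OF subspace_P] subspace_0[OF assms(3)] pcomp_zero_left[OF assms(1,2)] by simp
  qed (use assms(2) subspace_add[OF subspace_P] subspace_add[OF assms(3)] pcomp_add_left[OF assms(1)]
        subspace_scale[OF subspace_P] subspace_scale[OF assms(3)] pcomp_scale_left[OF assms(1)] in simp_all)
  then have "span S \<subseteq> {x \<in> P m. pcomp m n i x y \<in> T}"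
    by (rule span_minimal[rotated]) (use assms in auto)
  then show ?thesis using assms(6) by auto
qed

lemma pcomp_span_right:
  assumes "i \<in> {1..m}" "x \<in> P m" "subspace T" "S \<subseteq> P n"
    "\<And>y. y \<in> S \<Longrightarrow> pcomp m n i x y \<in> T" "y \<in> span S"
  shows "pcomp m n i x y \<in> T"
proof -
  have "subspace {y \<in> P n. pcomp m n i x y \<in> T}"
  proof (rule subspaceI)
    show "0 \<in> {y \<in> P n. pcomp m n i x y \<in> T}"
      using subspace_0[OF subspace_P] subspace_0[OF assms(3)] pcomp_zero_right[OF assms(1,2)] by simp
  qed (use assms(2) subspace_add[OF subspace_P] subspace_add[OF assms(3)] pcomp_add_right[OF assms(1)]
        subspace_scale[OF subspace_P] subspace_scale[OF assms(3)] pcomp_scale_right[OF assms(1)] in simp_all)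
  then have "span S \<subseteq> {y \<in> P n. pcomp m n i x y \<in> T}"
    by (rule span_minimal[rotated]) (use assms in auto)
  then show ?thesis using assms(6) by auto
qed

lemma alt_fixed_subset: "alt_fixed n \<subseteq> P n"
  by (auto simp: alt_fixed_def)

lemma alt_fixedD:
  assumes "x \<in> alt_fixed n" "p \<in> {1..n}" "q \<in> {1..n}" "p \<noteq> q" "p' \<in> {1..n}" "q' \<in> {1..n}" "p' \<noteq> q'"
  shows "act n x (transpose p q) = act n x (transpose p' q')"
  using assms unfolding alt_fixed_def transpositions_def by blast

lemma alt_fixed_eq:
  "x \<in> alt_fixed n \<Longrightarrow> t \<in> transpositions n \<Longrightarrow> t' \<in> transpositions n \<Longrightarrow> act n x t = act n x t'"
  unfolding alt_fixed_def by blast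

lemma alt_fixedI:
  "x \<in> P n \<Longrightarrow> (\<And>t t'. t \<in> transpositions n \<Longrightarrow> t' \<in> transpositions n \<Longrightarrow> act n x t = act n x t')
    \<Longrightarrow> x \<in> alt_fixed n"
  unfolding alt_fixed_def by blast

lemma subspace_alt_fixed: "subspace (alt_fixed n)"
proof (rule subspaceI)
  show "0 \<in> alt_fixed n"
  proof (rule alt_fixedI[OF subspace_0[OF subspace_P]])
    fix t t' assume t: "t \<in> transpositions n" "t' \<in> transpositions n"
    show "act n 0 t = act n 0 t'"
      unfolding act_zero[OF transpositions_permute[OF t(1)]] act_zero[OF transpositions_permute[OF t(2)]] ..
  qed
  show "x + y \<in> alt_fixed n" if x: "x \<in> alt_fixed n" and y: "y \<in> alt_fixed n" for x y
  proof -
    have xP: "x \<in> P n" "y \<in> P n" using x y alt_fixed_subset by auto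
    show ?thesis
    proof (rule alt_fixedI[OF subspace_add[OF subspace_P xP]])
      fix t t' assume t: "t \<in> transpositions n" "t' \<in> transpositions n"
      show "act n (x + y) t = act n (x + y) t'"
        using act_add[OF transpositions_permute[OF t(1)] xP] act_add[OF transpositions_permute[OF t(2)] xP]
          alt_fixed_eq[OF x t] alt_fixed_eq[OF y t] by simp
    qed
  qed
  show "scale c x \<in> alt_fixed n" if x: "x \<in> alt_fixed n" for c x
  proof -
    have xP: "x \<in> P n" using x alt_fixed_subset by auto
    show ?thesis
    proof (rule alt_fixedI[OF subspace_scale[OF subspace_P xP]])
      fix t t' assume t: "t \<in> transpositions n" "t' \<in> transpositions n"
      show "act n (scale c x) t = act n (scale c x) t'"
        using act_scale[OF transpositions_permute[OF t(1)] xP] act_scale[OF transpositions_permute[OF t(2)] xP]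
          alt_fixed_eq[OF x t] by simp
    qed
  qed
qed

text \<open>
  The alternating group is normal, so its fixed vectors are stable under all permutations.
\<close>
lemma act_alt_fixed:
  assumes x: "x \<in> alt_fixed n" and \<pi>: "\<pi> permutes {1..n}"
  shows "act n x \<pi> \<in> alt_fixed n"
proof -
  have xP: "x \<in> P n" using x alt_fixed_subset by blast
  have *: "\<exists>t'\<in>transpositions n. act n (act n x \<pi>) t = act n (act n x t') \<pi>" if t: "t \<in> transpositions n" for t
  proof -
    obtain p q where pq: "p \<in> {1..n}" "q \<in> {1..n}" "p \<noteq> q" "t = transpose p q"
      using t unfolding transpositions_def by blast
    have t': "transpose (\<pi> p) (\<pi> q) \<in> transpositions n"
      by (rule transpositionsI)
        (simp_all only: permutes_in_image[OF \<pi>] inj_eq[OF permutes_inj[OF \<pi>]] pq not_False_eq_True)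
    have "act n (act n x \<pi>) t = act n x (\<pi> \<circ> t)"
      using act_compose[OF \<pi> transpositions_permute[OF t] xP] by simp
    also have "\<dots> = act n x (transpose (\<pi> p) (\<pi> q) \<circ> \<pi>)"
      using conj_transpose[OF permutes_inj[OF \<pi>], of p q] pq(4) by simp
    also have "\<dots> = act n (act n x (transpose (\<pi> p) (\<pi> q))) \<pi>"
      by (rule act_compose[OF transpositions_permute[OF t'] \<pi> xP])
    finally show ?thesis using t' by blast
  qed
  have "act n (act n x \<pi>) t = act n (act n x \<pi>) t'"
    if t: "t \<in> transpositions n" "t' \<in> transpositions n" for t t'
  proof -
    obtain u where u: "u \<in> transpositions n" "act n (act n x \<pi>) t = act n (act n x u) \<pi>" using *[OF t(1)] by blast
    obtain u' where u': "u' \<in> transpositions n" "act n (act n x \<pi>) t' = act n (act n x u') \<pi>" using *[OF t(2)] by blast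
    have "act n x u = act n x u'" by (rule alt_fixed_eq[OF x u(1) u'(1)])
    then show ?thesis using u(2) u'(2) by simp
  qed
  then show ?thesis by (intro alt_fixedI act_closed[OF \<pi> xP])
qed

lemma act_transposition_twice:
  assumes "t \<in> transpositions n" "x \<in> P n"
  shows "act n (act n x t) t = x"
proof -
  have "t \<circ> t = id" using assms(1) by (auto simp: transpositions_def)
  then show ?thesis
    using act_compose[OF transpositions_permute[OF assms(1)] transpositions_permute[OF assms(1)] assms(2)]
      act_id[OF assms(2)] by simp
qed

abbreviation sw :: "nat \<Rightarrow> nat" where "sw \<equiv> transpose 1 2"

lemma sw_in: "2 \<le> n \<Longrightarrow> sw \<in> transpositions n"
  by (rule transpositionsI) auto

lemma act_on_alt_fixed:
  assumes "x \<in> alt_fixed n" and "2 \<le> n" and "\<sigma> permutes {1..n}"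
  shows "act n x \<sigma> = x \<or> act n x \<sigma> = act n x sw"
proof -
  have "\<forall>x\<in>alt_fixed n. act n x \<sigma> = x \<or> act n x \<sigma> = act n x sw"
    using assms(3) finite_atLeastAtMost
  proof (induction rule: permutes_induct)
    case id
    then show ?case using act_id alt_fixed_subset by blast
  next
    case (swap a b p)
    show ?case
    proof
      fix x assume x: "x \<in> alt_fixed n"
      have t: "transpose a b \<in> transpositions n" by (rule transpositionsI[OF swap.hyps(1-3)])
      have sw: "sw \<in> transpositions n" using sw_in[OF assms(2)] .
      have xP: "x \<in> P n" using x alt_fixed_subset by blast
      have tsw: "act n x (transpose a b) = act n x sw" by (rule alt_fixed_eq[OF x t sw])
      have "act n x (transpose a b \<circ> p) = act n (act n x sw) p"
        using act_compose[OF transpositions_permute[OF t] swap.hyps(4) xP] tsw by simp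
      moreover have "act n x sw \<in> alt_fixed n" by (rule act_alt_fixed[OF x transpositions_permute[OF sw]])
      moreover have "act n (act n x sw) sw = x" by (rule act_transposition_twice[OF sw xP])
      ultimately show "act n x (transpose a b \<circ> p) = x \<or> act n x (transpose a b \<circ> p) = act n x sw"
        using swap.IH by metis
    qed
  qed
  then show ?thesis using assms(1) by blast
qed

text \<open>
  The alternating groups of the complements of two disjoint blocks generate the whole alternating group
  if the complements have two common points. A transposition of a point of one
  block with a point of the other is handled by conjugating with a transposition through the common
  point \<open>c\<close>.
\<close>
lemma alt_fixed_of_two_blocks:
  assumes T: "T \<in> P n" and disj: "U \<inter> V = {}"
    and U: "\<And>p q p' q'. {p, q, p', q'} \<subseteq> {1..n} - U \<Longrightarrow> p \<noteq> q \<Longrightarrow> p' \<noteq> q' \<Longrightarrow>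
        act n T (transpose p q) = act n T (transpose p' q')"
    and V: "\<And>p q p' q'. {p, q, p', q'} \<subseteq> {1..n} - V \<Longrightarrow> p \<noteq> q \<Longrightarrow> p' \<noteq> q' \<Longrightarrow>
        act n T (transpose p q) = act n T (transpose p' q')"
    and c: "c \<in> {1..n} - (U \<union> V)" "c' \<in> {1..n} - (U \<union> V)" "c \<noteq> c'"
  shows "T \<in> alt_fixed n"
proof -
  have glue: "act n T (transpose p q) = act n T (transpose c c')"
    if p: "p \<in> {1..n} - V" and q: "q \<in> {1..n} - U" and ne: "p \<noteq> q" "p \<noteq> c" "q \<noteq> c" for p q
  proof -
    have tp: "transpose p c permutes {1..n}" "transpose q c permutes {1..n}"
      using p q c by (auto intro!: permutes_swap_id)
    have "transpose q c \<in> transpositions n" unfolding transpositions_def using q c ne by blast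
    then have tw: "act n (act n T (transpose q c)) (transpose q c) = T"
      using act_transposition_twice T by blast
    have ep: "act n T (transpose p c) = act n T (transpose c c')" by (rule V) (use p c ne in auto)
    have eq: "act n T (transpose q c) = act n T (transpose c c')" by (rule U) (use q c ne in auto)
    have "transpose p q = (transpose p c \<circ> transpose q c) \<circ> transpose p c"
      using ne by (auto simp: fun_eq_iff transpose_def)
    then have "act n T (transpose p q) = act n (act n (act n T (transpose p c)) (transpose q c)) (transpose p c)"
      using act_compose[OF permutes_compose[OF tp(2,1)] tp(1) T] act_compose[OF tp T] by simp
    also have "\<dots> = act n T (transpose p c)" using ep eq tw by simp
    finally show ?thesis using ep by simp
  qed
  have "act n T (transpose p q) = act n T (transpose c c')"
    if pq: "p \<in> {1..n}" "q \<in> {1..n}" "p \<noteq> q" for p q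
  proof -
    consider "p \<notin> U" "q \<notin> U" | "p \<notin> V" "q \<notin> V" | "p \<in> U" "q \<in> V" | "p \<in> V" "q \<in> U" using disj by blast
    then show ?thesis
    proof cases
      case 1
      then show ?thesis using U[of p q c c'] pq c by auto
    next
      case 2
      then show ?thesis using V[of p q c c'] pq c by auto
    next
      case 3
      then show ?thesis using glue[of p q] disj pq c by auto
    next
      case 4
      then show ?thesis using glue[of q p] disj pq c by (auto simp: transpose_commute)
    qed
  qed
  then have "act n T t = act n T (transpose c c')" if "t \<in> transpositions n" for t
    using that unfolding transpositions_def by blast
  then show ?thesis by (intro alt_fixedI[OF T]) (metis (no_types))
qed

section \<open>Composing with vectors fixed by the alternating group\<close>

lemma pcomp_act_left:
  assumes "i \<in> {1..m}" "\<sigma> permutes {1..m}" "x \<in> P m" "y \<in> P n"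
  shows "pcomp m n i (act m x \<sigma>) y = act (m + n - 1) (pcomp m n (\<sigma> i) x y) (block_perm n i \<sigma> id)"
  using equivariance[OF assms(1,2) permutes_id assms(3,4)] act_id[OF assms(4)] by simp

lemma pcomp_act_right:
  assumes "i \<in> {1..m}" "\<tau> permutes {1..n}" "x \<in> P m" "y \<in> P n"
  shows "pcomp m n i x (act n y \<tau>) = act (m + n - 1) (pcomp m n i x y) (block_perm n i id \<tau>)"
  using equivariance[OF assms(1) permutes_id assms(2,3,4)] act_id[OF assms(3)] by simp

lemma pcomp_transpose_outside:
  assumes i: "i \<in> {1..m}" and n: "0 < n" and x: "x \<in> P m" and y: "y \<in> P n"
    and p: "p \<in> {1..m}" "p \<noteq> i" and q: "q \<in> {1..m}" "q \<noteq> i"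
  shows "pcomp m n i (act m x (transpose p q)) y =
      act (m + n - 1) (pcomp m n i x y) (transpose (outer_pos n i p) (outer_pos n i q))"
  using pcomp_act_left[OF i permutes_swap_id[OF p(1) q(1)] x y] block_perm_transpose[OF n _ p(2) q(2)] i p q
  by simp

text \<open>
  Invariance of the outer operation under even permutations passes to those even permutations of the
  composite that fix the inserted block pointwise.
\<close>
lemma pcomp_alt_fixed_outside:
  assumes i: "i \<in> {1..m}" and n: "0 < n" and x: "x \<in> alt_fixed m" and y: "y \<in> P n"
    and sub: "{p, q, p', q'} \<subseteq> {1..m + n - 1} - {i..<i + n}" and ne: "p \<noteq> q" "p' \<noteq> q'"
  shows "act (m + n - 1) (pcomp m n i x y) (transpose p q) =
         act (m + n - 1) (pcomp m n i x y) (transpose p' q')"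
proof -
  have xP: "x \<in> P m" using x alt_fixed_subset by blast
  have ex: "\<exists>k. k \<in> {1..m} \<and> k \<noteq> i \<and> j = outer_pos n i k" if j: "j \<in> {1..m + n - 1} - {i..<i + n}" for j
  proof -
    have "1 \<le> i" using i by simp
    then show ?thesis
    proof (cases rule: position_cases[of i j n])
      case (1 k)
      then show ?thesis using outer_pos_in[OF n i 1(1)] j by auto
    next
      case (2 t)
      then show ?thesis using j i by auto
    qed
  qed
  have main: "act (m + n - 1) (pcomp m n i x y) (transpose u v) = pcomp m n i (act m x (transpose a b)) y"
    if "u = outer_pos n i a" "v = outer_pos n i b" "a \<in> {1..m}" "b \<in> {1..m}" "a \<noteq> i" "b \<noteq> i" for u v a b
    using pcomp_transpose_outside[OF i n xP y that(3,5,4,6)] that(1,2) by simp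
  obtain a b where ab: "a \<in> {1..m}" "a \<noteq> i" "p = outer_pos n i a" "b \<in> {1..m}" "b \<noteq> i" "q = outer_pos n i b"
    using ex[of p] ex[of q] sub by blast
  obtain a' b' where ab': "a' \<in> {1..m}" "a' \<noteq> i" "p' = outer_pos n i a'"
      "b' \<in> {1..m}" "b' \<noteq> i" "q' = outer_pos n i b'"
    using ex[of p'] ex[of q'] sub by blast
  have "a \<noteq> b" "a' \<noteq> b'" using ne ab ab' by auto
  then have "act m x (transpose a b) = act m x (transpose a' b')"
    using alt_fixedD[OF x] ab ab' by blast
  then show ?thesis using main[OF ab(3,6,1,4,2,5)] main[OF ab'(3,6,1,4,2,5)] by simp
qed

text \<open>
  Replace the transposition \<open>(i j)\<close>, which moves the inserted block, by a transposition \<open>(a b)\<close> that does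
  not: both act on \<open>x\<close> in the same way. Equivariance applied to the two sides gives the relation.
\<close>
lemma pcomp_change_input:
  assumes i: "i \<in> {1..m}" and j: "j \<in> {1..m}" and m: "4 \<le> m" and n: "0 < n"
    and x: "x \<in> alt_fixed m" and y: "y \<in> P n"
  shows "\<exists>\<pi>. \<pi> permutes {1..m + n - 1} \<and> pcomp m n j x y = act (m + n - 1) (pcomp m n i x y) \<pi>"
proof (cases "i = j")
  case True
  then show ?thesis using act_id pcomp_closed[OF i] x y alt_fixed_subset permutes_id
    by (metis subsetD)
next
  case False
  have xP: "x \<in> P m" using x alt_fixed_subset by blast
  have "card {i, j} + 2 \<le> card {1..m}" using m False by simp
  then obtain a b where ab: "a \<in> {1..m} - {i, j}" "b \<in> {1..m} - {i, j}" "a \<noteq> b"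
    by (rule two_further_points[rotated 2]) auto
  have tp: "transpose i j permutes {1..m}" "transpose a b permutes {1..m}"
    using ab i j by (auto intro!: permutes_swap_id)
  define \<beta> where "\<beta> = block_perm n i (transpose i j) id"
  define \<gamma> where "\<gamma> = block_perm n i (transpose a b) id"
  have \<beta>: "\<beta> permutes {1..m + n - 1}" and \<gamma>: "\<gamma> permutes {1..m + n - 1}"
    unfolding \<beta>_def \<gamma>_def by (rule block_perm_permutes[OF i _ permutes_id n], fact tp)+
  have Tj: "pcomp m n j x y \<in> P (m + n - 1)" and Ti: "pcomp m n i x y \<in> P (m + n - 1)"
    by (rule pcomp_closed[OF j xP y], rule pcomp_closed[OF i xP y])
  have "act m x (transpose i j) = act m x (transpose a b)"
    using alt_fixedD[OF x, of i j a b] i j ab False by simp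
  then have "act (m + n - 1) (pcomp m n j x y) \<beta> = act (m + n - 1) (pcomp m n i x y) \<gamma>"
    using pcomp_act_left[OF i tp(1) xP y] pcomp_act_left[OF i tp(2) xP y] ab
    by (simp add: \<beta>_def \<gamma>_def)
  then have "act (m + n - 1) (act (m + n - 1) (pcomp m n j x y) \<beta>) (inv \<beta>) =
      act (m + n - 1) (act (m + n - 1) (pcomp m n i x y) \<gamma>) (inv \<beta>)" by simp
  then have "act (m + n - 1) (pcomp m n j x y) (\<beta> \<circ> inv \<beta>) = act (m + n - 1) (pcomp m n i x y) (\<gamma> \<circ> inv \<beta>)"
    using act_compose[OF \<beta> permutes_inv[OF \<beta>] Tj] act_compose[OF \<gamma> permutes_inv[OF \<beta>] Ti] by simp
  then have "pcomp m n j x y = act (m + n - 1) (pcomp m n i x y) (\<gamma> \<circ> inv \<beta>)"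
    using permutes_inv_o(1)[OF \<beta>] act_id[OF Tj] by simp
  moreover have "\<gamma> \<circ> inv \<beta> permutes {1..m + n - 1}" by (rule permutes_compose[OF permutes_inv[OF \<beta>] \<gamma>])
  ultimately show ?thesis by blast
qed

text \<open>
  By parallel associativity the composite is of the form \<open>X \<circ> v\<close> and of the form \<open>Y \<circ> u\<close> with \<open>X\<close> and \<open>Y\<close>
  fixed by alternating groups, so it is invariant outside the block of \<open>v\<close> and outside that of \<open>u\<close>.
\<close>
lemma two_branches_alt_fixed:
  assumes ab: "a \<in> {1..l}" "b \<in> {1..l}" "a < b" and l: "4 \<le> l" and mn: "0 < m" "0 < n"
    and x: "x \<in> P l" and u: "u \<in> P m" and v: "v \<in> P n"
    and xu: "pcomp l m a x u \<in> alt_fixed (l + m - 1)" and xv: "pcomp l n b x v \<in> alt_fixed (l + n - 1)"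
  shows "pcomp (l + m - 1) n (b + m - 1) (pcomp l m a x u) v \<in> alt_fixed (l + m - 1 + n - 1)"
proof -
  let ?T = "pcomp (l + m - 1) n (b + m - 1) (pcomp l m a x u) v"
  have T2: "?T = pcomp (l + n - 1) m a (pcomp l n b x v) u"
    by (rule parallel_assoc[OF ab x u v])
  have N: "l + n - 1 + m - 1 = l + m - 1 + n - 1" using mn by simp
  have bi: "b + m - 1 \<in> {1..l + m - 1}" using ab mn by auto
  have ai: "a \<in> {1..l + n - 1}" using ab mn by auto
  let ?U = "{a..<a + m}" and ?V = "{b + m - 1..<b + m - 1 + n}"
  have "card (?U \<union> ?V) \<le> m + n" using card_Un_le[of ?U ?V] by simp
  then have "card (?U \<union> ?V) + 2 \<le> card {1..l + m - 1 + n - 1}" using l mn by simp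
  then obtain c c' where c: "c \<in> {1..l + m - 1 + n - 1} - (?U \<union> ?V)"
      "c' \<in> {1..l + m - 1 + n - 1} - (?U \<union> ?V)" "c \<noteq> c'"
    by (rule two_further_points[rotated 2]) auto
  show ?thesis
  proof (rule alt_fixed_of_two_blocks[OF _ _ _ _ c])
    show "?T \<in> P (l + m - 1 + n - 1)" using pcomp_closed[OF bi _ v] xu alt_fixed_subset by blast
    show "?U \<inter> ?V = {}" using ab by auto
    show "act (l + m - 1 + n - 1) ?T (transpose p q) = act (l + m - 1 + n - 1) ?T (transpose p' q')"
      if "{p, q, p', q'} \<subseteq> {1..l + m - 1 + n - 1} - ?U" "p \<noteq> q" "p' \<noteq> q'" for p q p' q'
      using pcomp_alt_fixed_outside[OF ai mn(1) xv u, of p q p' q'] that unfolding T2 N by simp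
    show "act (l + m - 1 + n - 1) ?T (transpose p q) = act (l + m - 1 + n - 1) ?T (transpose p' q')"
      if "{p, q, p', q'} \<subseteq> {1..l + m - 1 + n - 1} - ?V" "p \<noteq> q" "p' \<noteq> q'" for p q p' q'
      using pcomp_alt_fixed_outside[OF bi mn(2) xu v, of p q p' q'] that by simp
  qed
qed

section \<open>Operads generated in bounded arity\<close>

text \<open>
  In terms of trees of operations, these are the trees with a vertex of arity between \<open>2\<close> and \<open>d\<close> all of
  whose inputs are leaves.
\<close>
definition top_composites :: "nat \<Rightarrow> nat \<Rightarrow> 'a set" where
  "top_composites d n = {act n (pcomp m r i x y) \<sigma> |m r i x y \<sigma>.
     i \<in> {1..m} \<and> 2 \<le> r \<and> r \<le> d \<and> m + r - 1 = n \<and> x \<in> P m \<and> y \<in> P r \<and> \<sigma> permutes {1..n}}"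

lemma top_compositesI:
  assumes "i \<in> {1..m}" "2 \<le> r" "r \<le> d" "m + r - 1 = n" "x \<in> P m" "y \<in> P r" "\<sigma> permutes {1..n}"
  shows "act n (pcomp m r i x y) \<sigma> \<in> span (top_composites d n)"
  unfolding top_composites_def using assms by (intro span_base) blast

lemma top_compositesI_id:
  assumes "i \<in> {1..m}" "2 \<le> r" "r \<le> d" "m + r - 1 = n" "x \<in> P m" "y \<in> P r"
  shows "pcomp m r i x y \<in> span (top_composites d n)"
  using top_compositesI[OF assms permutes_id] act_id pcomp_closed[OF assms(1,5,6)] assms(4) by simp

lemma top_composites_subset: "top_composites d n \<subseteq> P n"
proof
  fix z assume "z \<in> top_composites d n"
  then obtain m r i x y \<sigma> where "z = act n (pcomp m r i x y) \<sigma>" "i \<in> {1..m}" "m + r - 1 = n"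
      "x \<in> P m" "y \<in> P r" "\<sigma> permutes {1..n}"
    unfolding top_composites_def by blast
  then show "z \<in> P n" using act_closed pcomp_closed by blast
qed

lemma span_top_composites_subset: "span (top_composites d n) \<subseteq> P n"
  by (rule span_minimal[OF top_composites_subset subspace_P])

lemma act_top_composites:
  assumes \<pi>: "\<pi> permutes {1..n}" and x: "x \<in> span (top_composites d n)"
  shows "act n x \<pi> \<in> span (top_composites d n)"
proof (rule act_span[OF \<pi> subspace_span top_composites_subset _ x])
  fix z assume "z \<in> top_composites d n"
  then obtain m r i x y \<sigma> where z: "z = act n (pcomp m r i x y) \<sigma>" and h: "i \<in> {1..m}" "2 \<le> r" "r \<le> d"
      "m + r - 1 = n" "x \<in> P m" "y \<in> P r" and \<sigma>: "\<sigma> permutes {1..n}"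
    unfolding top_composites_def by blast
  have "pcomp m r i x y \<in> P n" using pcomp_closed[OF h(1,5,6)] h(4) by simp
  then have "act n z \<pi> = act n (pcomp m r i x y) (\<sigma> \<circ> \<pi>)" using z act_compose[OF \<sigma> \<pi>] by simp
  then show "act n z \<pi> \<in> span (top_composites d n)"
    using top_compositesI[OF h permutes_compose[OF \<pi> \<sigma>]] by simp
qed

text \<open>
  A unary operation substituted into a composite can be absorbed either into the top operation or into
  the rest.
\<close>
lemma pcomp_unary_top_composites:
  assumes i: "i \<in> {1..n}" and y: "y \<in> P 1" and x: "x \<in> span (top_composites d n)"
  shows "pcomp n 1 i x y \<in> span (top_composites d n)"
proof (rule pcomp_span_left[OF i y subspace_span top_composites_subset _ x])
  fix z assume "z \<in> top_composites d n"
  then obtain m r j u v \<sigma> where z: "z = act n (pcomp m r j u v) \<sigma>" and h: "j \<in> {1..m}" "2 \<le> r" "r \<le> d"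
      "m + r - 1 = n" "u \<in> P m" "v \<in> P r" and \<sigma>: "\<sigma> permutes {1..n}"
    unfolding top_composites_def by blast
  have uv: "pcomp m r j u v \<in> P n" using pcomp_closed[OF h(1,5,6)] h(4) by simp
  let ?s = "\<sigma> i"
  have s: "?s \<in> {1..n}" using i permutes_in_image[OF \<sigma>] by simp
  have "pcomp n 1 ?s (pcomp m r j u v) y \<in> span (top_composites d n)"
  proof -
    have j1: "1 \<le> j" using h(1) by simp
    have r0: "0 < r" using h(2) by simp
    show ?thesis
      using j1
    proof (cases rule: position_cases[of j ?s r])
      case (2 t)
      have "pcomp (m + r - 1) 1 (j + t - 1) (pcomp m r j u v) y = pcomp m (r + 1 - 1) j u (pcomp r 1 t v y)"
        by (rule sequential_assoc[OF h(1) 2(1) h(5,6) y])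
      moreover have "pcomp r 1 t v y \<in> P r" using pcomp_closed[OF 2(1) h(6) y] by simp
      ultimately show ?thesis
        using top_compositesI_id[OF h(1-5)] h(4) 2(2) by simp
    next
      case (1 k)
      have k: "k \<in> {1..m}" using outer_pos_in[OF r0 h(1) 1(1)] s 1(2) h(4) by simp
      have uy: "pcomp m 1 k u y \<in> P m" using pcomp_closed[OF k h(5) y] by simp
      consider "j < k" | "k < j" using 1(1) by linarith
      then show ?thesis
      proof cases
        case 1
        have "pcomp (m + r - 1) 1 (k + r - 1) (pcomp m r j u v) y = pcomp (m + 1 - 1) r j (pcomp m 1 k u y) v"
          by (rule parallel_assoc[OF h(1) k 1 h(5,6) y])
        moreover have "?s = k + r - 1" using \<open>?s = outer_pos r j k\<close> 1 by (simp add: outer_pos_def)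
        ultimately show ?thesis using top_compositesI_id[OF h(1-4) uy h(6)] h(4) by simp
      next
        case 2
        have "pcomp (m + 1 - 1) r (j + 1 - 1) (pcomp m 1 k u y) v = pcomp (m + r - 1) 1 k (pcomp m r j u v) y"
          by (rule parallel_assoc[OF k h(1) 2 h(5) y h(6)])
        moreover have "?s = k" using \<open>?s = outer_pos r j k\<close> 2 by (simp add: outer_pos_def)
        ultimately show ?thesis using top_compositesI_id[OF h(1-4) uy h(6)] h(4) by simp
      qed
    qed
  qed
  then have "act n (pcomp n 1 ?s (pcomp m r j u v) y) (block_perm 1 i \<sigma> id) \<in> span (top_composites d n)"
    using act_top_composites block_perm_permutes[OF i \<sigma> permutes_id[of "{1..1}"]] by simp
  then show "pcomp n 1 i z y \<in> span (top_composites d n)"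
    using pcomp_act_left[OF i \<sigma> uv y] z by simp
qed

lemma pcomp_right_top_composites:
  assumes i: "i \<in> {1..m}" and x: "x \<in> P m" and n: "0 < n" and y: "y \<in> span (top_composites d n)"
  shows "pcomp m n i x y \<in> span (top_composites d (m + n - 1))"
proof (rule pcomp_span_right[OF i x subspace_span top_composites_subset _ y])
  fix z assume "z \<in> top_composites d n"
  then obtain k r j u v \<sigma> where z: "z = act n (pcomp k r j u v) \<sigma>" and h: "j \<in> {1..k}" "2 \<le> r" "r \<le> d"
      "k + r - 1 = n" "u \<in> P k" "v \<in> P r" and \<sigma>: "\<sigma> permutes {1..n}"
    unfolding top_composites_def by blast
  have uv: "pcomp k r j u v \<in> P n" using pcomp_closed[OF h(1,5,6)] h(4) by simp
  have "pcomp (m + k - 1) r (i + j - 1) (pcomp m k i x u) v = pcomp m (k + r - 1) i x (pcomp k r j u v)"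
    by (rule sequential_assoc[OF i h(1) x h(5,6)])
  moreover have "pcomp m k i x u \<in> P (m + k - 1)" by (rule pcomp_closed[OF i x h(5)])
  moreover have "i + j - 1 \<in> {1..m + k - 1}" using i h(1) by auto
  moreover have "m + k - 1 + r - 1 = m + n - 1" using h(1,2,4) by auto
  ultimately have "pcomp m n i x (pcomp k r j u v) \<in> span (top_composites d (m + n - 1))"
    using top_compositesI_id[of "i + j - 1" "m + k - 1" r d "m + n - 1" "pcomp m k i x u" v] h by simp
  then have "act (m + n - 1) (pcomp m n i x (pcomp k r j u v)) (block_perm n i id \<sigma>)
      \<in> span (top_composites d (m + n - 1))"
    by (rule act_top_composites[OF block_perm_permutes[OF i permutes_id \<sigma> n]])
  then show "pcomp m n i x z \<in> span (top_composites d (m + n - 1))"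
    using pcomp_act_right[OF i \<sigma> x uv] z by simp
qed

text \<open>
  The components \<open>P n\<close> for \<open>n \<le> d\<close> and the spans of composites for \<open>n > d\<close> form a suboperad that
  contains the generators.
\<close>
lemma top_composites_span:
  assumes red: "reduced" and gen: "\<And>n. generated_suboperad X n = P n"
    and X: "X \<subseteq> Sigma UNIV P" and d: "\<And>k x. (k, x) \<in> X \<Longrightarrow> k \<le> d" "1 \<le> d" and n: "d < n"
  shows "P n = span (top_composites d n)"
proof -
  define Q where "Q n = (if n \<le> d then P n else span (top_composites d n))" for n
  have QP: "Q n \<subseteq> P n" for n using span_top_composites_subset by (simp add: Q_def)
  have "suboperad Q"
    unfolding suboperad_def
  proof (intro conjI allI ballI impI)
    show "subspace (Q n)" for n using subspace_P by (simp add: Q_def)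
    show "Q n \<subseteq> P n" for n by (rule QP)
    show "unit \<in> Q 1" using unit_in d(2) by (simp add: Q_def)
    show "act n x \<sigma> \<in> Q n" if "x \<in> Q n" "\<sigma> permutes {1..n}" for n x \<sigma>
      using that act_closed act_top_composites by (simp add: Q_def split: if_splits)
    show "pcomp m n i x y \<in> Q (m + n - 1)" if i: "i \<in> {1..m}" and x: "x \<in> Q m" and y: "y \<in> Q n" for m n i x y
    proof -
      have xP: "x \<in> P m" and yP: "y \<in> P n" using x y QP by auto
      consider "m + n - 1 \<le> d" | "n = 0" | "n = 1" "d < m" | "d < n" | "2 \<le> n" "n \<le> d" "d < m + n - 1"
        by linarith
      then show ?thesis
      proof cases
        case 1
        then show ?thesis using pcomp_closed[OF i xP yP] by (simp add: Q_def)
      next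
        case 2
        then have "y = 0" using yP red by (simp add: reduced_def)
        moreover have "subspace (Q (m + n - 1))" using subspace_P by (simp add: Q_def)
        ultimately show ?thesis using pcomp_zero_right[OF i xP] subspace_0 by simp
      next
        case 3
        then show ?thesis using pcomp_unary_top_composites[OF i, of y x d] x yP by (simp add: Q_def)
      next
        case 4
        then have "d < m + n - 1" using i by auto
        then show ?thesis using 4 pcomp_right_top_composites[OF i xP, of n y d] y by (simp add: Q_def)
      next
        case 5
        then show ?thesis using top_compositesI_id[OF i 5(1,2) _ xP yP] by (simp add: Q_def)
      qed
    qed
  qed
  moreover have "\<forall>(k, x)\<in>X. x \<in> Q k" using X d(1) by (auto simp: Q_def)
  ultimately have "generated_suboperad X n \<subseteq> Q n" unfolding generated_suboperad_def by blast
  then show ?thesis using gen[of n] QP[of n] n by (simp add: Q_def)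
qed

text \<open>
  An element of \<open>P n\<close> is a sum of composites \<open>x \<circ> y\<close>, where \<open>x\<close> is in turn a sum of composites
  \<open>u \<circ> v\<close>. As \<open>u \<circ> v\<close> has good arity, \<open>y\<close> may be moved to an input that belongs to \<open>u\<close>; then \<open>v\<close> and
  \<open>y\<close> sit on different inputs of \<open>u\<close>.
\<close>
lemma alt_fixed_propagates:
  assumes span: "\<And>k. d < k \<Longrightarrow> P k = span (top_composites d k)"
    and d: "1 \<le> d" and n: "3 * d + 4 \<le> n"
    and prev: "\<And>k. n - d \<le> k \<Longrightarrow> k < n \<Longrightarrow> P k = alt_fixed k"
  shows "P n = alt_fixed n"
proof
  show "alt_fixed n \<subseteq> P n" by (rule alt_fixed_subset)
  have "top_composites d n \<subseteq> alt_fixed n"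
  proof
    fix z assume "z \<in> top_composites d n"
    then obtain m r i x y \<sigma> where z: "z = act n (pcomp m r i x y) \<sigma>" and h: "i \<in> {1..m}" "2 \<le> r" "r \<le> d"
        "m + r - 1 = n" "x \<in> P m" "y \<in> P r" and \<sigma>: "\<sigma> permutes {1..n}"
      unfolding top_composites_def by blast
    have m: "P m = alt_fixed m" "d < m" "4 \<le> m" using prev[of m] h n d by auto
    have xs: "x \<in> span (top_composites d m)" using span[OF m(2)] h(5) by simp
    have sub: "top_composites d m \<subseteq> {x \<in> P m. pcomp m r i x y \<in> alt_fixed n}"
    proof
      fix z' assume z'in: "z' \<in> top_composites d m"
      then obtain l s j u v \<tau> where z': "z' = act m (pcomp l s j u v) \<tau>" and h': "j \<in> {1..l}" "2 \<le> s" "s \<le> d"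
          "l + s - 1 = m" "u \<in> P l" "v \<in> P s" and \<tau>: "\<tau> permutes {1..m}"
        unfolding top_composites_def by blast
      have l: "4 \<le> l" using h h' n by simp
      have uvP: "pcomp l s j u v \<in> P m" using pcomp_closed[OF h'(1,5,6)] h'(4) by simp
      then have uv: "pcomp l s j u v \<in> alt_fixed (l + s - 1)" using m(1) h'(4) by simp
      have mn: "l + r - 1 = n - s + 1" "n - d \<le> l + r - 1" "l + r - 1 < n" using h h' by auto
      have uy: "pcomp l r k u y \<in> alt_fixed (l + r - 1)" if "k \<in> {1..l}" for k
        using pcomp_closed[OF that h'(5) h(6)] prev[OF mn(2,3)] by simp
      have rs: "0 < r" "0 < s" using h h' by auto
      have "\<exists>i'\<in>{1..m}. pcomp m r i' (pcomp l s j u v) y \<in> alt_fixed n"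
      (* The free input of u on which y is placed: the last one, or the first one if v occupies the last. *)
      proof (cases "j < l")
        case True
        have "pcomp (l + s - 1) r (l + s - 1) (pcomp l s j u v) y \<in> alt_fixed (l + s - 1 + r - 1)"
          by (rule two_branches_alt_fixed[OF h'(1) _ True l rs(2,1) h'(5,6) h(6) uv uy]) (use l in auto)
        then show ?thesis using h'(4) h(4) m(3) by (intro bexI[of _ m]) auto
      next
        case False
        then have j: "1 < j" using h'(1) l by auto
        have one: "1 \<in> {1..l}" using l by simp
        have "pcomp (l + r - 1) s (j + r - 1) (pcomp l r 1 u y) v \<in> alt_fixed (l + r - 1 + s - 1)"
          by (rule two_branches_alt_fixed[OF one h'(1) j l rs h'(5) h(6) h'(6) uy[OF one] uv])
        moreover have "pcomp (l + r - 1) s (j + r - 1) (pcomp l r 1 u y) v =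
            pcomp (l + s - 1) r 1 (pcomp l s j u v) y"
          by (rule parallel_assoc[OF one h'(1) j h'(5) h(6) h'(6)])
        moreover have "l + r - 1 + s - 1 = n" using h h' by auto
        ultimately show ?thesis using h'(4) m(3) by (intro bexI[of _ 1]) auto
      qed
      then obtain i' where i': "i' \<in> {1..m}" "pcomp m r i' (pcomp l s j u v) y \<in> alt_fixed n" by blast
      have uvm: "pcomp l s j u v \<in> alt_fixed m" using uvP m(1) by simp
      have ti: "\<tau> i \<in> {1..m}" using permutes_in_image[OF \<tau>] h(1) by simp
      obtain \<pi> where \<pi>: "\<pi> permutes {1..m + r - 1}"
          "pcomp m r (\<tau> i) (pcomp l s j u v) y = act (m + r - 1) (pcomp m r i' (pcomp l s j u v) y) \<pi>"
        using pcomp_change_input[OF i'(1) ti m(3) rs(1) uvm h(6)] by blast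
      have "pcomp m r (\<tau> i) (pcomp l s j u v) y \<in> alt_fixed n"
        using act_alt_fixed[OF i'(2)] \<pi> h(4) by simp
      then have "act n (pcomp m r (\<tau> i) (pcomp l s j u v) y) (block_perm r i \<tau> id) \<in> alt_fixed n"
        by (rule act_alt_fixed) (use block_perm_permutes[OF h(1) \<tau> permutes_id rs(1)] h(4) in simp)
      then have "pcomp m r i z' y \<in> alt_fixed n"
        using pcomp_act_left[OF h(1) \<tau> uvP h(6)] h(4) z' by simp
      then show "z' \<in> {x \<in> P m. pcomp m r i x y \<in> alt_fixed n}"
        using z'in top_composites_subset by blast
    qed
    have "pcomp m r i x y \<in> alt_fixed n"
      by (rule pcomp_span_left[OF h(1,6) subspace_alt_fixed top_composites_subset _ xs])
        (use sub in blast)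
    then show "z \<in> alt_fixed n" using act_alt_fixed[OF _ \<sigma>] z by simp
  qed
  then have "span (top_composites d n) \<subseteq> alt_fixed n" by (rule span_minimal[OF _ subspace_alt_fixed])
  then show "P n \<subseteq> alt_fixed n" using span[of n] n d by simp
qed

end

section \<open>Commuting involutions\<close>

context vector_space
begin

text \<open>
  Involutions \<open>A\<close> have the eigenvector \<open>v + A v\<close>, unless \<open>A v = - v\<close>. The condition \<open>A 0 v = - A 1 v\<close>
  survives the successive replacements because it is linear and all operators commute; it will force
  the eigenvalues of \<open>A 0\<close> and \<open>A 1\<close> to differ.
\<close>
lemma joint_eigenvector:
  fixes A :: "nat \<Rightarrow> 'b \<Rightarrow> 'b"
  assumes V: "subspace V"
    and closed: "\<And>j x. j < m \<Longrightarrow> x \<in> V \<Longrightarrow> A j x \<in> V"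
    and add: "\<And>j x y. j < m \<Longrightarrow> x \<in> V \<Longrightarrow> y \<in> V \<Longrightarrow> A j (x + y) = A j x + A j y"
    and scl: "\<And>j x k. j < m \<Longrightarrow> x \<in> V \<Longrightarrow> A j (scale k x) = scale k (A j x)"
    and invol: "\<And>j x. j < m \<Longrightarrow> x \<in> V \<Longrightarrow> A j (A j x) = x"
    and comm: "\<And>j k x. j < m \<Longrightarrow> k < m \<Longrightarrow> x \<in> V \<Longrightarrow> A j (A k x) = A k (A j x)"
    and m: "2 \<le> m" and y: "y \<in> V" "A 0 y \<noteq> A 1 y"
  shows "\<exists>v\<in>V. v \<noteq> 0 \<and> A 0 v = - A 1 v \<and> (\<forall>j<m. A j v = v \<or> A j v = - v)"
proof -
  have mn: "A j (- x) = - A j x" if "j < m" "x \<in> V" for j x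
    using scl[OF that, of "- 1"] by simp
  have "\<exists>v\<in>V. v \<noteq> 0 \<and> A 0 v = - A 1 v \<and> (\<forall>j<k. A j v = v \<or> A j v = - v)" if "k \<le> m" for k
    using that
  proof (induction k)
    case 0
    have 01: "0 < m" "1 < m" using m by auto
    have yc: "A 0 y \<in> V" "A 1 y \<in> V" "- A 1 y \<in> V"
      using closed[OF 01(1) y(1)] closed[OF 01(2) y(1)] subspace_neg[OF V] by auto
    define z where "z = A 0 y + - A 1 y"
    have "A 0 z = y - A 0 (A 1 y)"
      unfolding z_def add[OF 01(1) yc(1,3)] mn[OF 01(1) yc(2)] invol[OF 01(1) y(1)] by simp
    moreover have "A 1 z = A 1 (A 0 y) - y"
      unfolding z_def add[OF 01(2) yc(1,3)] mn[OF 01(2) yc(2)] invol[OF 01(2) y(1)] by simp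
    ultimately have "A 0 z = - A 1 z" using comm[OF 01 y(1)] by simp
    moreover have "z \<in> V" unfolding z_def by (rule subspace_add[OF V yc(1,3)])
    moreover have "z \<noteq> 0" using y(2) by (simp add: z_def)
    ultimately show ?case by blast
  next
    case (Suc k)
    then obtain v where v: "v \<in> V" "v \<noteq> 0" "A 0 v = - A 1 v" "\<And>j. j < k \<Longrightarrow> A j v = v \<or> A j v = - v"
      by auto
    have k: "k < m" using Suc(2) by simp
    show ?case
    proof (cases "A k v = - v")
      case True
      then have "\<forall>j<Suc k. A j v = v \<or> A j v = - v" using v(4) less_Suc_eq by auto
      then show ?thesis using v by blast
    next
      case False
      define u where "u = v + A k v"
      have kv: "A k v \<in> V" by (rule closed[OF k v(1)])
      have u: "u \<in> V" unfolding u_def by (rule subspace_add[OF V v(1) kv])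
      have un: "u \<noteq> 0" using False by (simp add: u_def eq_neg_iff_add_eq_0 add.commute)
      have Au: "A j u = A j v + A k (A j v)" if "j < m" for j
        unfolding u_def add[OF that v(1) kv] comm[OF that k v(1)] ..
      have "A 0 u = - A 1 u"
        using Au[of 0] Au[of 1] m v(3) mn[OF k closed[of 1 v]] v(1) by simp
      moreover have "A j u = u \<or> A j u = - u" if j: "j < Suc k" for j
      proof (cases "j = k")
        case True
        then show ?thesis using Au[OF k] invol[OF k v(1)] by (simp add: u_def add.commute)
      next
        case False
        then have "A j v = v \<or> A j v = - v" "j < m" using v(4) j k by auto
        then show ?thesis using Au[of j] mn[OF k v(1)] by (auto simp: u_def)
      qed
      ultimately show ?thesis using u un by blast
    qed
  qed
  then show ?thesis by blast
qed

end

context symmetric_operad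
begin

text \<open>
  Let \<open>v\<close> be a joint eigenvector of the transpositions \<open>T j\<close> of a perfect matching (up to one point if
  \<open>n\<close> is odd) for a nonconstant character. Let \<open>s\<close> be one of the two eigenvalues and \<open>b\<close> a place
  at which the other one occurs. Exchanging the \<open>b\<close>-th edge of the matching with the \<open>a\<close>-th,
  for each \<open>a\<close> with eigenvalue \<open>s\<close>, gives an eigenvector \<open>w a\<close> whose character is \<open>- s\<close> at
  \<open>a\<close> and \<open>s\<close> at all other such places. These vectors are linearly independent, so each of
  the two eigenvalues occurs at most \<open>dim (P n)\<close> times.
\<close>
lemma dim_ge_of_not_alt_fixed:
  assumes lf: "locally_finite" and two: "(2::'k) \<noteq> 0" and n: "8 \<le> n" and ne: "P n \<noteq> alt_fixed n"
  shows "n div 2 \<le> 2 * dim (P n)"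
proof -
  obtain BB where BB: "finite BB" "span BB = P n" using lf unfolding locally_finite_def by blast
  obtain x p q p' q' where x: "x \<in> P n" and pq: "p \<in> {1..n}" "q \<in> {1..n}" "p \<noteq> q"
      "p' \<in> {1..n}" "q' \<in> {1..n}" "p' \<noteq> q'" and
      xne: "act n x (transpose p q) \<noteq> act n x (transpose p' q')"
    using ne unfolding alt_fixed_def transpositions_def by blast
  (* The two transpositions may overlap; a third one, disjoint from both, differs from one of them
     in its action on x, and so supplies the first two edges of the matching. *)
  have "card {p, q, p', q'} + 2 \<le> card {1..n}"
    using n card_insert_le_m1[of 4 "{q, p', q'}" p] by (simp add: card_insert_if)
  then obtain e f where ef: "e \<in> {1..n} - {p, q, p', q'}" "f \<in> {1..n} - {p, q, p', q'}" "e \<noteq> f"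
    by (rule two_further_points[rotated 2]) auto
  obtain a b where ab: "a \<in> {1..n}" "b \<in> {1..n}" "a \<noteq> b" "a \<noteq> e" "a \<noteq> f" "b \<noteq> e" "b \<noteq> f"
      "act n x (transpose a b) \<noteq> act n x (transpose e f)"
  proof (cases "act n x (transpose p q) = act n x (transpose e f)")
    case True
    then show ?thesis using that[of p' q'] pq ef xne by auto
  next
    case False
    then show ?thesis using that[of p q] pq ef by auto
  qed
  define xs where "xs = [a, b, e, f] @ sorted_list_of_set ({1..n} - {a, b, e, f})"
  have set_xs: "set xs = {1..n}" using ab ef unfolding xs_def by auto
  have dxs: "distinct xs" unfolding xs_def using ab ef by auto
  have len: "length xs = n" using distinct_card[OF dxs] set_xs by simp
  define m where "m = n div 2"
  have m2: "2 \<le> m" using n by (simp add: m_def)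
  have idx: "2 * j < n" "2 * j + 1 < n" if "j < m" for j using that by (auto simp: m_def)
  have nth_in: "xs ! i \<in> {1..n}" if "i < n" for i using that set_xs len nth_mem by blast
  have nth_eq: "xs ! i = xs ! j \<longleftrightarrow> i = j" if "i < n" "j < n" for i j
    using nth_eq_iff_index_eq[OF dxs] that len by simp
  define T where "T j = transpose (xs ! (2 * j)) (xs ! (2 * j + 1))" for j
  have Tin: "T j \<in> transpositions n" if "j < m" for j
    unfolding T_def
    by (rule transpositionsI[OF nth_in nth_in]) (use idx[OF that] nth_eq in auto)
  have Tperm: "T j permutes {1..n}" if "j < m" for j by (rule transpositions_permute[OF Tin[OF that]])
  define A where "A j v = act n v (T j)" for j v
  have Tcomm: "T j \<circ> T k = T k \<circ> T j" if "j < m" "k < m" for j k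
  proof (cases "j = k")
    case False
    then have "2 * j \<noteq> 2 * k" "2 * j \<noteq> 2 * k + 1" "2 * j + 1 \<noteq> 2 * k" "2 * j + 1 \<noteq> 2 * k + 1"
      by presburger+
    then have "xs ! (2 * j) \<noteq> xs ! (2 * k)" "xs ! (2 * j) \<noteq> xs ! (2 * k + 1)"
        "xs ! (2 * j + 1) \<noteq> xs ! (2 * k)" "xs ! (2 * j + 1) \<noteq> xs ! (2 * k + 1)"
      using idx[OF that(1)] idx[OF that(2)] by (simp_all only: nth_eq not_False_eq_True)
    then show ?thesis unfolding T_def by (auto simp: fun_eq_iff transpose_def)
  qed simp
  have "xs ! 0 = a" "xs ! 1 = b" "xs ! 2 = e" "xs ! 3 = f" by (simp_all add: xs_def)
  then have "A 0 x \<noteq> A 1 x" using ab(8) by (simp add: A_def T_def numeral_3_eq_3)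
  then have "\<exists>v\<in>P n. v \<noteq> 0 \<and> A 0 v = - A 1 v \<and> (\<forall>j<m. A j v = v \<or> A j v = - v)"
  proof (intro joint_eigenvector[OF subspace_P _ _ _ _ _ m2 x])
    fix j k :: nat and x assume j: "j < m" and x: "x \<in> P n"
    show "A j x \<in> P n" unfolding A_def by (rule act_closed[OF Tperm[OF j] x])
    show "A j (A j x) = x" unfolding A_def by (rule act_transposition_twice[OF Tin[OF j] x])
    show "A j (scale c x) = scale c (A j x)" for c unfolding A_def by (rule act_scale[OF Tperm[OF j] x])
    show "A j (x + y) = A j x + A j y" if "y \<in> P n" for y unfolding A_def by (rule act_add[OF Tperm[OF j] x that])
    show "A j (A k x) = A k (A j x)" if k: "k < m"
      unfolding A_def
      using act_compose[OF Tperm[OF j] Tperm[OF k] x] act_compose[OF Tperm[OF k] Tperm[OF j] x]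
        Tcomm[OF j k] by simp
  qed
  then obtain v where v: "v \<in> P n" "v \<noteq> 0" "A 0 v = - A 1 v" "\<And>j. j < m \<Longrightarrow> A j v = v \<or> A j v = - v"
    by blast
  have bound: "card {j. j < m \<and> A j v = scale s v} \<le> dim (P n)"
    if s: "s * s = 1" and b: "b < m" "A b v = scale (- s) v" for s b
  proof -
    define S where "S = {j. j < m \<and> A j v = scale s v}"
    have "s \<noteq> 0" using s by auto
    have ss: "u = 0" if "scale s u = scale (- s) u" for u
    proof -
      have "scale (s - - s) u = 0" unfolding scale_left_diff_distrib that by (rule diff_self)
      then have "s - - s = 0 \<or> u = 0" by (simp only: scale_eq_0_iff)
      moreover have "s - - s = 2 * s" by simp
      ultimately show ?thesis using two \<open>s \<noteq> 0\<close> by (metis mult_eq_0_iff)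
    qed
    have bS: "b \<notin> S" using ss[of v] b v(2) by (auto simp: S_def)
    define g where "g a = transpose (xs ! (2 * a)) (xs ! (2 * b)) \<circ> transpose (xs ! (2 * a + 1)) (xs ! (2 * b + 1))"
      for a
    have gperm: "g a permutes {1..n}" if "a < m" for a
      unfolding g_def
      by (intro permutes_compose permutes_swap_id nth_in idx that b(1))
    have gnth: "g a (xs ! (2 * j)) = xs ! (2 * transpose a b j)"
        "g a (xs ! (2 * j + 1)) = xs ! (2 * transpose a b j + 1)"
      if "a < m" "j < m" for a j
    proof -
      note ii = idx[OF that(1)] idx[OF that(2)] idx[OF b(1)]
      have odd: "2 * u + 1 = 2 * w + 1 \<longleftrightarrow> u = w" "2 * u + 1 \<noteq> 2 * w" "2 * u \<noteq> 2 * w + 1" for u w :: nat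
        by presburger+
      have e: "xs ! (2 * u) = xs ! (2 * w) \<longleftrightarrow> u = w" "xs ! (2 * u + 1) = xs ! (2 * w + 1) \<longleftrightarrow> u = w"
          "xs ! (2 * u) \<noteq> xs ! (2 * w + 1)" "xs ! (2 * u + 1) \<noteq> xs ! (2 * w)"
        if "u < m" "w < m" for u w
        using nth_eq idx[OF that(1)] idx[OF that(2)] odd by simp_all
      show "g a (xs ! (2 * j)) = xs ! (2 * transpose a b j)"
        unfolding g_def comp_def transpose_def[of "xs ! (2 * a + 1)"]
        using e[OF that(2,1)] e[OF that(2) b(1)] by (auto simp: transpose_def)
      show "g a (xs ! (2 * j + 1)) = xs ! (2 * transpose a b j + 1)"
        unfolding g_def comp_def transpose_def
        using e[OF that(2,1)] e[OF that(2) b(1)] e[OF that(1,1)] e[OF that(1) b(1)] e[OF b(1) that(1)] e[OF b(1,1)]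
        by auto
    qed
    define w where "w a = act n v (g a)" for a
    have wP: "w a \<in> P n" if "a < m" for a unfolding w_def by (rule act_closed[OF gperm[OF that] v(1)])
    have wn: "w a \<noteq> 0" if "a < m" for a
    proof
      assume "w a = 0"
      have "act n (w a) (inv (g a)) = v"
        unfolding w_def
        using act_compose[OF gperm[OF that] permutes_inv[OF gperm[OF that]] v(1)]
          permutes_inv_o(1)[OF gperm[OF that]] act_id[OF v(1)] by simp
      then show False using \<open>w a = 0\<close> act_zero[OF permutes_inv[OF gperm[OF that]]] v(2) by simp
    qed
    have Aw: "A j (w a) = act n (A (transpose a b j) v) (g a)" if a: "a < m" and j: "j < m" for a j
    proof -
      have t: "transpose a b j < m" using a b(1) j by (simp add: transpose_def)
      have "g a \<circ> T j = transpose (g a (xs ! (2 * j))) (g a (xs ! (2 * j + 1))) \<circ> g a"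
        unfolding T_def by (rule conj_transpose[OF permutes_inj[OF gperm[OF a]]])
      also have "\<dots> = T (transpose a b j) \<circ> g a" unfolding gnth[OF a j] T_def ..
      finally have "g a \<circ> T j = T (transpose a b j) \<circ> g a" .
      then show ?thesis
        unfolding A_def w_def
        using act_compose[OF gperm[OF a] Tperm[OF j] v(1)] act_compose[OF Tperm[OF t] gperm[OF a] v(1)] by simp
    qed
    have A1: "A j (w a) = scale s (w a)" if "a \<in> S" "j \<in> S" "j \<noteq> a" for a j
    proof -
      have "a < m" "j < m" "j \<noteq> b" using that bS by (auto simp: S_def)
      then show ?thesis
        using Aw[of a j] that act_scale[OF gperm v(1)] by (simp add: S_def w_def)
    qed
    have A2: "A a (w a) = scale (- s) (w a)" if "a \<in> S" for a
    proof -
      have a: "a < m" using that by (simp add: S_def)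
      show ?thesis using Aw[OF a a] b act_scale[OF gperm[OF a] v(1), of "- s"] by (simp add: w_def)
    qed
    have key: "w a \<notin> span (w ` (S - {a}))" if a: "a \<in> S" for a
    proof
      assume in_span: "w a \<in> span (w ` (S - {a}))"
      have am: "a < m" using a by (simp add: S_def)
      note lin = act_add[OF Tperm[OF am]] act_scale[OF Tperm[OF am]]
      have "A a (w a) - scale s (w a) \<in> {0}"
      proof -
        have "subspace {x \<in> P n. A a x = scale s x}"
        proof (rule subspaceI)
          show "0 \<in> {x \<in> P n. A a x = scale s x}"
            using subspace_0[OF subspace_P] act_zero[OF Tperm[OF am]] by (simp add: A_def)
          show "x + y \<in> {x \<in> P n. A a x = scale s x}"
            if "x \<in> {x \<in> P n. A a x = scale s x}" "y \<in> {x \<in> P n. A a x = scale s x}" for x y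
            using that subspace_add[OF subspace_P] lin(1)[of x y] by (simp add: A_def scale_right_distrib)
          show "scale c x \<in> {x \<in> P n. A a x = scale s x}" if "x \<in> {x \<in> P n. A a x = scale s x}" for c x
            using that subspace_scale[OF subspace_P] lin(2)[of x c] by (simp add: A_def mult.commute)
        qed
        moreover have "w ` (S - {a}) \<subseteq> {x \<in> P n. A a x = scale s x}"
          using A1[OF _ a] wP by (auto simp: S_def)
        ultimately have "span (w ` (S - {a})) \<subseteq> {x \<in> P n. A a x = scale s x}" by (rule span_minimal[rotated])
        then show ?thesis using in_span by auto
      qed
      then have "scale s (w a) = scale (- s) (w a)" using A2[OF a] by simp
      then show False using ss[of "w a"] wn[OF am] by simp
    qed
    have inj: "inj_on w S"
    proof (rule inj_onI, rule ccontr)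
      fix a c assume "a \<in> S" "c \<in> S" "w a = w c" "a \<noteq> c"
      then have "w a \<in> w ` (S - {a})" by auto
      then have "w a \<in> span (w ` (S - {a}))" by (rule span_base)
      with key[OF \<open>a \<in> S\<close>] show False by (rule notE)
    qed
    have "independent (w ` S)"
      unfolding dependent_def
    proof
      assume "\<exists>u\<in>w ` S. u \<in> span (w ` S - {u})"
      then obtain a where a: "a \<in> S" "w a \<in> span (w ` S - {w a})" by blast
      have "w ` S - {w a} \<subseteq> w ` (S - {a})" by auto
      then have "span (w ` S - {w a}) \<subseteq> span (w ` (S - {a}))" by (rule span_mono)
      then have "w a \<in> span (w ` (S - {a}))" using a(2) by (rule subsetD)
      with key[OF a(1)] show False by (rule notE)
    qed
    moreover have "w ` S \<subseteq> P n" using wP by (auto simp: S_def)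
    ultimately have "card (w ` S) \<le> dim (P n)" using card_le_dim_of_finitely_spanned[OF BB] by blast
    then show ?thesis using inj by (simp add: card_image S_def)
  qed
  obtain b0 b1 where b: "b0 < m" "A b0 v = v" "b1 < m" "A b1 v = - v"
  proof -
    have "0 < m" "1 < m" using m2 by auto
    have "A 1 v = - A 0 v" using v(3) by simp
    then consider "A 0 v = v" "A 1 v = - v" | "A 1 v = v" "A 0 v = - v"
      using v(4)[OF \<open>0 < m\<close>] by (metis minus_minus)
    then show ?thesis using that \<open>0 < m\<close> \<open>1 < m\<close> by cases blast+
  qed
  have "card {j. j < m \<and> A j v = scale 1 v} \<le> dim (P n)" by (rule bound[of 1 b1]) (use b in auto)
  moreover have "card {j. j < m \<and> A j v = scale (- 1) v} \<le> dim (P n)" by (rule bound[of "- 1" b0]) (use b in auto)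
  moreover have "{..<m} = {j. j < m \<and> A j v = scale 1 v} \<union> {j. j < m \<and> A j v = scale (- 1) v}"
    using v(4) by auto
  then have "m \<le> card {j. j < m \<and> A j v = scale 1 v} + card {j. j < m \<and> A j v = scale (- 1) v}"
    using card_Un_le by (metis card_lessThan)
  ultimately show ?thesis by (simp add: m_def)
qed

lemma growth_of_GKdim:
  assumes "GKdim = 1"
  shows "\<forall>\<^sub>F n in sequentially. real (\<Sum>i\<le>n. dim (P i)) \<le> real n powr (3/2)"
proof -
  have "limsup (\<lambda>n. ereal (log (real n) (real (\<Sum>i\<le>n. dim (P i))))) < ereal (3/2)"
    using assms unfolding GKdim_def by (simp add: one_ereal_def del: of_nat_sum)
  from Limsup_lessD[OF this] eventually_ge_at_top[of 2]
  show ?thesis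
  proof eventually_elim
    case (elim n)
    define s where "s = (\<Sum>i\<le>n. dim (P i))"
    have lt: "log (real n) (real s) < 3/2" using elim(1) by (simp add: s_def)
    have "real s \<le> real n powr (3/2)"
    proof (cases "s = 0")
      case False
      then have "real s = real n powr log (real n) (real s)" using elim(2) by (simp add: powr_log_cancel)
      also have "\<dots> \<le> real n powr (3/2)" using lt elim(2) by (intro powr_mono) auto
      finally show ?thesis .
    qed simp
    then show ?case by (simp add: s_def)
  qed
qed

text \<open>
  If each of the windows of length \<open>d + 1\<close> beyond \<open>u0\<close> contained a bad arity, the \<open>k\<close>-th of them would
  contribute at least \<open>(k - 1) / 4\<close> to the sum of the dimensions. So some window is good, and
  goodness propagates from it.
\<close>
lemma eventually_alt_fixed:
  assumes lf: "locally_finite" and two: "(2::'k) \<noteq> 0"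
    and growth: "\<forall>\<^sub>F n in sequentially. real (\<Sum>i\<le>n. dim (P i)) \<le> real n powr (3/2)"
    and span: "\<And>k. d < k \<Longrightarrow> P k = span (top_composites d k)" and d: "1 \<le> d"
  shows "\<exists>w. \<forall>n\<ge>w. P n = alt_fixed n"
proof -
  define u0 where "u0 = 3 * d + 8"
  have "\<exists>u\<ge>u0. \<forall>n. u \<le> n \<and> n \<le> u + d \<longrightarrow> P n = alt_fixed n"
  proof (rule ccontr)
    assume "\<not> ?thesis"
    then have "\<exists>n. u \<le> n \<and> n \<le> u + d \<and> P n \<noteq> alt_fixed n" if "u0 \<le> u" for u using that by blast
    then have "\<exists>n. u0 + (d + 1) * k \<le> n \<and> n \<le> u0 + (d + 1) * k + d \<and> P n \<noteq> alt_fixed n" for k by simp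
    then obtain N where N: "\<And>k. u0 + (d + 1) * k \<le> N k" "\<And>k. N k \<le> u0 + (d + 1) * k + d"
        "\<And>k. P (N k) \<noteq> alt_fixed (N k)" by metis
    have "N k < N (Suc k)" for k using N(2)[of k] N(1)[of "Suc k"] by simp
    then have inj: "strict_mono N" by (rule strict_mono_Suc_iff[THEN iffD2, rule_format])
    have low: "(real k - 1) / 4 \<le> real (dim (P (N k)))" for k
    proof -
      have "k \<le> (d + 1) * k" by simp
      then have kN: "k \<le> N k" using N(1)[of k] by linarith
      have "N k div 2 \<le> 2 * dim (P (N k))"
        by (rule dim_ge_of_not_alt_fixed[OF lf two _ N(3)]) (use N(1)[of k] in \<open>simp add: u0_def\<close>)
      then have "k \<le> 4 * dim (P (N k)) + 1" using kN by linarith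
      then have "real k \<le> real (4 * dim (P (N k)) + 1)" by (rule of_nat_mono)
      then show ?thesis by simp
    qed
    have "(real K)^2 / 8 - real K \<le> real (\<Sum>i\<le>u0 + (d + 1) * K. dim (P i))" for K
    proof -
      have "(real K)^2 / 8 - real K \<le> (\<Sum>k<K. (real k - 1) / 4)"
        by (induction K) (auto simp: power2_eq_square field_simps)
      also have "\<dots> \<le> (\<Sum>k<K. real (dim (P (N k))))" by (intro sum_mono low)
      also have "\<dots> = real (\<Sum>i\<in>N ` {..<K}. dim (P i))"
        using inj by (subst sum.reindex) (auto simp: strict_mono_on_imp_inj_on strict_mono_imp_inj_on inj_on_def strict_mono_eq)
      also have "\<dots> \<le> real (\<Sum>i\<le>u0 + (d + 1) * K. dim (P i))"
      proof (intro of_nat_mono sum_mono2)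
        show "N ` {..<K} \<subseteq> {..u0 + (d + 1) * K}"
        proof
          fix i assume "i \<in> N ` {..<K}"
          then obtain k where k: "k < K" "i = N k" by auto
          have "(d + 1) * Suc k \<le> (d + 1) * K" using k(1) by (intro mult_le_mono2) simp
          then show "i \<in> {..u0 + (d + 1) * K}" using N(2)[of k] k(2) by simp
        qed
      qed auto
      finally show ?thesis .
    qed
    with quadratic_growth_contradiction[OF growth, of "d + 1" u0] show False by simp
  qed
  then obtain u where u: "u0 \<le> u" "\<And>n. u \<le> n \<Longrightarrow> n \<le> u + d \<Longrightarrow> P n = alt_fixed n" by blast
  have "P n = alt_fixed n" if "u \<le> n" for n
    using that
  proof (induction n rule: less_induct)
    case (less n)
    show ?case
    proof (cases "n \<le> u + d")
      case False
      show ?thesis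
      proof (rule alt_fixed_propagates[OF span d])
        show "3 * d + 4 \<le> n" using less(2) u(1) by (simp add: u0_def)
        show "P k = alt_fixed k" if "n - d \<le> k" "k < n" for k
          by (rule less(1)) (use that False in auto)
      qed
    qed (use u(2) less(2) in simp)
  qed
  then show ?thesis by blast
qed

end

section \<open>Operators that commute up to sign\<close>

definition up_to_sign :: "'a::ab_group_add \<Rightarrow> 'a \<Rightarrow> bool" where
  "up_to_sign x y \<longleftrightarrow> x = y \<or> x = - y"

lemma up_to_sign_refl: "up_to_sign x x"
  by (simp add: up_to_sign_def)

lemma up_to_sign_sym: "up_to_sign x y \<Longrightarrow> up_to_sign y x"
  by (auto simp: up_to_sign_def)

lemma up_to_sign_trans: "up_to_sign x y \<Longrightarrow> up_to_sign y z \<Longrightarrow> up_to_sign x z"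
  by (auto simp: up_to_sign_def)

primrec canonical_word :: "nat \<Rightarrow> (nat \<Rightarrow> nat) \<Rightarrow> nat list" where
  "canonical_word 0 f = []"
| "canonical_word (Suc r) f = canonical_word r f @ replicate (f (Suc r)) (Suc r)"

lemma set_canonical_word: "set (canonical_word r f) \<subseteq> {1..r}"
  by (induction r) auto

lemma count_canonical_word: "count (mset (canonical_word r f)) a = (if a \<in> {1..r} then f a else 0)"
  by (induction r) (auto simp: count_mset)

lemma mset_canonical_word_Suc:
  assumes "a \<in> {1..r}"
  shows "mset (canonical_word r (f(a := Suc (f a)))) = mset (a # canonical_word r f)"
  by (rule multiset_eqI) (use assms in \<open>auto simp: count_canonical_word\<close>)

lemma canonical_word_Nil: "(\<And>a. a \<in> {1..r} \<Longrightarrow> f a = 0) \<Longrightarrow> canonical_word r f = []"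
  by (induction r) auto

lemma weight_canonical_word: "weight c d r f = c (f 0) + sum_list (map d (canonical_word r f))"
proof -
  have "sum_list (map d (canonical_word r f)) = (\<Sum>a\<in>{1..r}. d a * f a)"
    by (induction r) (auto simp: sum_list_replicate mult.commute)
  then show ?thesis by (simp add: weight_def)
qed

text \<open>
  The argument \<open>n\<close> is the degree of the vector; it is tracked because the operators depend on the degree of
  their argument.
\<close>
primrec apply_word :: "(nat \<Rightarrow> nat \<Rightarrow> 'a \<Rightarrow> 'a) \<Rightarrow> (nat \<Rightarrow> nat) \<Rightarrow> nat list \<Rightarrow> nat \<Rightarrow> 'a \<Rightarrow> 'a" where
  "apply_word R d [] n x = x"
| "apply_word R d (a # ws) n x = R a (n + sum_list (map d ws)) (apply_word R d ws n x)"

text \<open>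
  \<open>C n\<close> need not be a subspace: it will consist of the vectors on which the transpositions act by a
  common sign, and a sum of two nonzero such vectors with different signs is not one.
\<close>
locale sign_commuting_operators =
  fixes C :: "nat \<Rightarrow> 'a::ab_group_add set"
    and R :: "nat \<Rightarrow> nat \<Rightarrow> 'a \<Rightarrow> 'a" and d :: "nat \<Rightarrow> nat" and r :: nat
  assumes closed: "a \<in> {1..r} \<Longrightarrow> x \<in> C n \<Longrightarrow> R a n x \<in> C (n + d a)"
    and minus: "a \<in> {1..r} \<Longrightarrow> x \<in> C n \<Longrightarrow> R a n (- x) = - R a n x"
    and comm: "a \<in> {1..r} \<Longrightarrow> b \<in> {1..r} \<Longrightarrow> x \<in> C n \<Longrightarrow>
        up_to_sign (R a (n + d b) (R b n x)) (R b (n + d a) (R a n x))"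
begin

lemma R_up_to_sign:
  assumes "a \<in> {1..r}" "y \<in> C n" "up_to_sign x y"
  shows "up_to_sign (R a n x) (R a n y)"
  using assms(3) minus[OF assms(1,2)] unfolding up_to_sign_def by auto

lemma apply_word_closed:
  "set ws \<subseteq> {1..r} \<Longrightarrow> x \<in> C n \<Longrightarrow> apply_word R d ws n x \<in> C (n + sum_list (map d ws))"
proof (induction ws)
  case (Cons a ws)
  have "R a (n + sum_list (map d ws)) (apply_word R d ws n x) \<in> C (n + sum_list (map d ws) + d a)"
    by (rule closed) (use Cons in auto)
  then show ?case by (simp add: ac_simps)
qed simp

lemma apply_word_move_front:
  "set (us @ a # vs) \<subseteq> {1..r} \<Longrightarrow> x \<in> C n \<Longrightarrow>
    up_to_sign (apply_word R d (us @ a # vs) n x) (apply_word R d (a # us @ vs) n x)"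
proof (induction us)
  case Nil
  then show ?case by (simp add: up_to_sign_refl)
next
  case (Cons u us)
  let ?k = "n + sum_list (map d (us @ vs))"
  let ?y = "apply_word R d (us @ vs) n x"
  have au: "a \<in> {1..r}" "u \<in> {1..r}" and sub: "set (us @ vs) \<subseteq> {1..r}" "set (us @ a # vs) \<subseteq> {1..r}"
    using Cons(2) by auto
  have y: "?y \<in> C ?k" by (rule apply_word_closed[OF sub(1) Cons(3)])
  have k: "n + sum_list (map d (us @ a # vs)) = ?k + d a" by simp
  have "up_to_sign (R u (?k + d a) (apply_word R d (us @ a # vs) n x)) (R u (?k + d a) (apply_word R d (a # us @ vs) n x))"
    by (rule R_up_to_sign[OF au(2) _ Cons(1)[OF sub(2) Cons(3)]]) (use closed[OF au(1) y] in simp)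
  moreover have "up_to_sign (R u (?k + d a) (R a ?k ?y)) (R a (?k + d u) (R u ?k ?y))"
    by (rule comm[OF au(2,1) y])
  ultimately have "up_to_sign (R u (?k + d a) (apply_word R d (us @ a # vs) n x)) (R a (?k + d u) (R u ?k ?y))"
    using up_to_sign_trans by (simp only: apply_word.simps) blast
  moreover have "n + sum_list (map d (u # us @ vs)) = ?k + d u" by simp
  ultimately show ?case by (simp only: append_Cons apply_word.simps k)
qed

text \<open>
  By moving letters to the front, words with the same letters have the same effect up to sign; so a
  monomial is determined up to sign by its exponents.
\<close>
lemma apply_word_mset:
  "mset ws = mset ws' \<Longrightarrow> set ws \<subseteq> {1..r} \<Longrightarrow> x \<in> C n \<Longrightarrow>
    up_to_sign (apply_word R d ws n x) (apply_word R d ws' n x)"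
proof (induction ws arbitrary: ws')
  case Nil
  then show ?case by (simp add: up_to_sign_refl)
next
  case (Cons a ws)
  have "a \<in> set ws'" using Cons(2) by (metis list.set_intros(1) mset_eq_setD)
  then obtain us vs where ws': "ws' = us @ a # vs" by (meson split_list)
  have ms: "mset ws = mset (us @ vs)" using Cons(2) by (simp add: ws')
  have sub: "set (us @ a # vs) \<subseteq> {1..r}" using Cons(2,3) ws' mset_eq_setD by blast
  then have suv: "set (us @ vs) \<subseteq> {1..r}" "a \<in> {1..r}" by auto
  have "set ws \<subseteq> {1..r}" using Cons(3) by simp
  then have IH: "up_to_sign (apply_word R d ws n x) (apply_word R d (us @ vs) n x)"
    by (rule Cons(1)[OF ms _ Cons(4)])
  have "sum_list (map d ws) = sum_list (map d (us @ vs))"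
    using ms by (metis mset_map sum_mset_sum_list)
  then have "up_to_sign (apply_word R d (a # ws) n x) (apply_word R d (a # us @ vs) n x)"
    using R_up_to_sign[OF suv(2) apply_word_closed[OF suv(1) Cons(4)] IH] by simp
  then show ?case
    unfolding ws' by (rule up_to_sign_trans[OF _ up_to_sign_sym[OF apply_word_move_front[OF sub Cons(4)]]])
qed

lemma R_monomial:
  assumes a: "a \<in> {1..r}" and x: "x \<in> C (c (f 0))"
  shows "up_to_sign (R a (weight c d r f) (apply_word R d (canonical_word r f) (c (f 0)) x))
    (apply_word R d (canonical_word r (f(a := Suc (f a)))) (c (f 0)) x)"
proof -
  have "up_to_sign (apply_word R d (a # canonical_word r f) (c (f 0)) x)
      (apply_word R d (canonical_word r (f(a := Suc (f a)))) (c (f 0)) x)"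
    by (rule apply_word_mset[OF mset_canonical_word_Suc[OF a, symmetric] _ x])
      (use a set_canonical_word[of r f] in auto)
  then show ?thesis by (simp add: weight_canonical_word)
qed

lemma monomial_closed:
  "x \<in> C (c (f 0)) \<Longrightarrow> apply_word R d (canonical_word r f) (c (f 0)) x \<in> C (weight c d r f)"
  unfolding weight_canonical_word by (rule apply_word_closed[OF set_canonical_word])

end

section \<open>Operads whose components are eventually fixed by the alternating groups\<close>

context symmetric_operad
begin

text \<open>
  The vectors on which all permutations act by the trivial or all by the sign character. The bound on the
  arity provides enough unused inputs for \<open>pcomp_change_input\<close>.
\<close>
definition sign_eigenvectors :: "nat \<Rightarrow> 'a set" where
  "sign_eigenvectors n = {x \<in> alt_fixed n. 4 \<le> n \<and> up_to_sign (act n x sw) x}"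

lemma sign_eigenvectors_alt: "x \<in> sign_eigenvectors n \<Longrightarrow> x \<in> alt_fixed n"
  by (simp add: sign_eigenvectors_def)

lemma sign_eigenvectors_P: "x \<in> sign_eigenvectors n \<Longrightarrow> x \<in> P n"
  using alt_fixed_subset by (auto simp: sign_eigenvectors_def)

lemma act_sign_eigenvector:
  assumes "x \<in> sign_eigenvectors n" "\<pi> permutes {1..n}"
  shows "up_to_sign (act n x \<pi>) x"
  using act_on_alt_fixed[OF sign_eigenvectors_alt[OF assms(1)] _ assms(2)] assms(1)
  by (auto simp: sign_eigenvectors_def up_to_sign_def)

lemma pcomp_minus_left: "i \<in> {1..m} \<Longrightarrow> x \<in> P m \<Longrightarrow> y \<in> P n \<Longrightarrow> pcomp m n i (- x) y = - pcomp m n i x y"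
  using pcomp_scale_left[of i m x y n "- 1"] by simp

lemma pcomp_sign_left:
  assumes "i \<in> {1..m}" "x \<in> P m" "y \<in> P n" "up_to_sign x' x"
  shows "up_to_sign (pcomp m n i x' y) (pcomp m n i x y)"
  using assms(4) pcomp_minus_left[OF assms(1-3)] by (auto simp: up_to_sign_def)

text \<open>
  Both sides can be computed with the transposition of the inputs \<open>2\<close> and \<open>3\<close> of \<open>x\<close>, which does not
  involve the first input, where \<open>y\<close> is inserted.
\<close>
lemma pcomp_sw:
  assumes x: "x \<in> alt_fixed n" and n: "4 \<le> n" and y: "y \<in> P s" and s: "0 < s"
    and T: "pcomp n s 1 x y \<in> alt_fixed (n + s - 1)"
  shows "act (n + s - 1) (pcomp n s 1 x y) sw = pcomp n s 1 (act n x sw) y"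
proof -
  have 1: "1 \<in> {1..n}" and 23: "2 \<in> {1..n}" "2 \<noteq> (1::nat)" "3 \<in> {1..n}" "3 \<noteq> (1::nat)" using n by auto
  have xP: "x \<in> P n" using x alt_fixed_subset by blast
  have "act n x sw = act n x (transpose 2 3)" by (rule alt_fixedD[OF x]) (use n in auto)
  then have "pcomp n s 1 (act n x sw) y =
      act (n + s - 1) (pcomp n s 1 x y) (transpose (outer_pos s 1 2) (outer_pos s 1 3))"
    using pcomp_transpose_outside[OF 1 s xP y 23] by simp
  also have "\<dots> = act (n + s - 1) (pcomp n s 1 x y) sw"
    by (rule alt_fixedD[OF T]) (use n s in \<open>auto simp: outer_pos_def\<close>)
  finally show ?thesis by simp
qed

lemma pcomp_sign_eigenvector:
  assumes x: "x \<in> sign_eigenvectors n" and y: "y \<in> P s" and s: "0 < s"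
    and T: "P (n + s - 1) = alt_fixed (n + s - 1)"
  shows "pcomp n s 1 x y \<in> sign_eigenvectors (n + s - 1)"
proof -
  have n: "4 \<le> n" "1 \<in> {1..n}" using x by (auto simp: sign_eigenvectors_def)
  have xP: "x \<in> P n" by (rule sign_eigenvectors_P[OF x])
  have Ta: "pcomp n s 1 x y \<in> alt_fixed (n + s - 1)" using pcomp_closed[OF n(2) xP y] T by simp
  have "up_to_sign (act n x sw) x" using x by (simp add: sign_eigenvectors_def)
  then have "up_to_sign (pcomp n s 1 (act n x sw) y) (pcomp n s 1 x y)"
    by (rule pcomp_sign_left[OF n(2) xP y])
  then show ?thesis
    unfolding sign_eigenvectors_def
    using Ta n(1) s pcomp_sw[OF sign_eigenvectors_alt[OF x] n(1) y s Ta] by simp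
qed

text \<open>
  Parallel associativity for the inputs \<open>1\<close> and \<open>2\<close>, followed by moving both compositions to
  the first input.
\<close>
lemma pcomp_commute_up_to_sign:
  assumes x: "x \<in> sign_eigenvectors n" and y: "y \<in> P s" "0 < s" and z: "z \<in> P t" "0 < t"
    and alt: "\<And>k. n \<le> k \<Longrightarrow> P k = alt_fixed k"
  shows "up_to_sign (pcomp (n + s - 1) t 1 (pcomp n s 1 x y) z) (pcomp (n + t - 1) s 1 (pcomp n t 1 x z) y)"
proof -
  have n: "4 \<le> n" "1 \<in> {1..n}" "2 \<in> {1..n}" using x by (auto simp: sign_eigenvectors_def)
  have xP: "x \<in> P n" by (rule sign_eigenvectors_P[OF x])
  have le: "n \<le> n + s - 1" "n \<le> n + t - 1" "n \<le> n + s - 1 + t - 1" using y z by auto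
  have xy: "pcomp n s 1 x y \<in> sign_eigenvectors (n + s - 1)"
    by (rule pcomp_sign_eigenvector[OF x y alt[OF le(1)]])
  have xz: "pcomp n t 1 x z \<in> sign_eigenvectors (n + t - 1)"
    by (rule pcomp_sign_eigenvector[OF x z alt[OF le(2)]])
  have xyz: "pcomp (n + s - 1) t 1 (pcomp n s 1 x y) z \<in> sign_eigenvectors (n + s - 1 + t - 1)"
    by (rule pcomp_sign_eigenvector[OF xy z alt[OF le(3)]])
  have par: "pcomp (n + s - 1) t (2 + s - 1) (pcomp n s 1 x y) z = pcomp (n + t - 1) s 1 (pcomp n t 2 x z) y"
    by (rule parallel_assoc[OF n(2,3) _ xP y(1) z(1)]) simp
  have pos: "1 \<in> {1..n + s - 1}" "2 + s - 1 \<in> {1..n + s - 1}" "4 \<le> n + s - 1" "1 \<in> {1..n + t - 1}"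
    using n y z by auto
  obtain \<pi> where \<pi>: "\<pi> permutes {1..n + s - 1 + t - 1}" "pcomp (n + s - 1) t (2 + s - 1) (pcomp n s 1 x y) z =
      act (n + s - 1 + t - 1) (pcomp (n + s - 1) t 1 (pcomp n s 1 x y) z) \<pi>"
    using pcomp_change_input[OF pos(1,2,3) z(2) sign_eigenvectors_alt[OF xy] z(1)] by blast
  have 1: "up_to_sign (pcomp (n + s - 1) t 1 (pcomp n s 1 x y) z)
      (pcomp (n + s - 1) t (2 + s - 1) (pcomp n s 1 x y) z)"
    unfolding \<pi>(2) by (rule up_to_sign_sym[OF act_sign_eigenvector[OF xyz \<pi>(1)]])
  obtain \<rho> where \<rho>: "\<rho> permutes {1..n + t - 1}" "pcomp n t 2 x z = act (n + t - 1) (pcomp n t 1 x z) \<rho>"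
    using pcomp_change_input[OF n(2,3,1) z(2) sign_eigenvectors_alt[OF x] z(1)] by blast
  have "up_to_sign (pcomp n t 2 x z) (pcomp n t 1 x z)"
    unfolding \<rho>(2) by (rule act_sign_eigenvector[OF xz \<rho>(1)])
  then have 2: "up_to_sign (pcomp (n + t - 1) s 1 (pcomp n t 2 x z) y) (pcomp (n + t - 1) s 1 (pcomp n t 1 x z) y)"
    by (rule pcomp_sign_left[OF pos(4) sign_eigenvectors_P[OF xz] y(1)])
  show ?thesis using up_to_sign_trans[OF 1] 2 unfolding par by blast
qed

text \<open>
  In characteristic different from \<open>2\<close>, a vector \<open>x\<close> is half the sum of \<open>x + x \<cdot> t\<close> and \<open>x - x \<cdot> t\<close>, where
  \<open>t\<close> is a transposition.
\<close>
lemma sign_eigenvectors_span: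
  assumes two: "(2::'k) \<noteq> 0" and n: "4 \<le> n" and alt: "P n = alt_fixed n" and lf: "locally_finite"
  shows "\<exists>B. finite B \<and> B \<subseteq> sign_eigenvectors n \<and> P n \<subseteq> span B"
proof -
  obtain B where B: "finite B" "B \<subseteq> P n" "span B = P n" using lf unfolding locally_finite_def by blast
  have sw: "sw permutes {1..n}" "sw \<in> transpositions n"
    using sw_in[of n] transpositions_permute n by auto
  define B' where "B' = (\<lambda>x. x + act n x sw) ` B \<union> (\<lambda>x. x - act n x sw) ` B"
  have mem: "x + act n x sw \<in> sign_eigenvectors n \<and> x - act n x sw \<in> sign_eigenvectors n" if "x \<in> B" for x
  proof -
    have x: "x \<in> P n" using that B(2) by blast
    have sx: "act n x sw \<in> P n" by (rule act_closed[OF sw(1) x])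
    have ssx: "act n (act n x sw) sw = x" by (rule act_transposition_twice[OF sw(2) x])
    have "act n (x + act n x sw) sw = x + act n x sw"
      using act_add[OF sw(1) x sx] ssx by (simp add: add.commute)
    moreover have "act n (x - act n x sw) sw = - (x - act n x sw)"
      using act_diff[OF sw(1) x sx] ssx by simp
    ultimately show ?thesis
      unfolding sign_eigenvectors_def up_to_sign_def
      using alt n subspace_add[OF subspace_P x sx] subspace_diff[OF subspace_P x sx] by simp
  qed
  have "B \<subseteq> span B'"
  proof
    fix x assume x: "x \<in> B"
    have "(x + act n x sw) + (x - act n x sw) \<in> span B'"
      using x by (intro span_add span_base) (auto simp: B'_def)
    moreover have "(x + act n x sw) + (x - act n x sw) = scale 2 x"
      using scale_left_distrib[of 1 1 x] by simp
    ultimately have "scale (inverse 2) (scale 2 x) \<in> span B'" by (metis span_scale)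
    then show "x \<in> span B'" using two by simp
  qed
  then have "P n \<subseteq> span B'" using B(3) span_minimal subspace_span by blast
  moreover have "finite B'" "B' \<subseteq> sign_eigenvectors n" using B(1) mem by (auto simp: B'_def)
  ultimately show ?thesis by blast
qed

text \<open>
  The operators are \<open>x \<mapsto> x \<circ>\<^sub>1 y\<close>, where \<open>(arity of y, y)\<close> runs through the list \<open>Y\<close> of spanning vectors of
  \<open>P 2, \<dots>, P d\<close>, and the module generators are sign eigenvectors that span \<open>P n\<close> for
  \<open>w \<le> n \<le> w + d\<close>. In arity \<open>0\<close> there is no first input, so the operators are set to zero
  there.
\<close>
lemma monomial_module_of_alt_fixed:
  assumes two: "(2::'k) \<noteq> 0" and lf: "locally_finite" and red: "reduced"
    and growth: "\<forall>\<^sub>F n in sequentially. real (\<Sum>i\<le>n. dim (P i)) \<le> real n powr (3/2)"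
    and span: "\<And>k. d < k \<Longrightarrow> P k = span (top_composites d k)" and d: "2 \<le> d"
    and w: "4 \<le> w" "d \<le> w" and alt: "\<And>n. w \<le> n \<Longrightarrow> P n = alt_fixed n"
  shows "\<exists>Y c q mon. (\<forall>a\<in>{1..length Y}. 2 \<le> fst (Y ! (a - 1)) \<and> snd (Y ! (a - 1)) \<in> P (fst (Y ! (a - 1)))) \<and>
    monomial_module scale P
      (\<lambda>a n x. if n = 0 then 0 else pcomp n (fst (Y ! (a - 1))) 1 x (snd (Y ! (a - 1))))
      c (\<lambda>a. fst (Y ! (a - 1)) - 1) q (length Y) w mon"
proof -
  have "\<forall>n. \<exists>B. finite B \<and> B \<subseteq> P n \<and> span B = P n" using lf unfolding locally_finite_def .
  then obtain BB where BB: "\<And>n. finite (BB n)" "\<And>n. BB n \<subseteq> P n" "\<And>n. span (BB n) = P n" by metis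
  have "\<forall>n. w \<le> n \<longrightarrow> (\<exists>B. finite B \<and> B \<subseteq> sign_eigenvectors n \<and> P n \<subseteq> span B)"
    using sign_eigenvectors_span[OF two _ alt lf] w(1) by (meson order_trans)
  then obtain EE where EE: "\<And>n. w \<le> n \<Longrightarrow> finite (EE n)" "\<And>n. w \<le> n \<Longrightarrow> EE n \<subseteq> sign_eigenvectors n"
      "\<And>n. w \<le> n \<Longrightarrow> P n \<subseteq> span (EE n)" by metis
  (* The zero vector of P 2 keeps the list of operators from being empty. *)
  have "finite (insert (2, 0) (SIGMA s:{2..d}. BB s))" using BB(1) by simp
  then obtain Y where Y: "set Y = insert (2, 0) (SIGMA s:{2..d}. BB s)" using finite_list by blast
  have "finite (SIGMA n:{w..w + d}. EE n)" using EE(1) by (intro finite_SigmaI) auto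
  then obtain G where G: "set G = (SIGMA n:{w..w + d}. EE n)" using finite_list by blast
  define r where "r = length Y"
  define ar where "ar a = fst (Y ! (a - 1))" for a
  define el where "el a = snd (Y ! (a - 1))" for a
  define \<delta> where "\<delta> a = ar a - 1" for a
  define R where "R a n x = (if n = 0 then 0 else pcomp n (ar a) 1 x (el a))" for a n x
  define c where "c j = fst (G ! j)" for j
  define mon where "mon f = apply_word R \<delta> (canonical_word r f) (c (f 0)) (snd (G ! (f 0)))" for f
  have Yin: "2 \<le> ar a \<and> el a \<in> P (ar a)" if "a \<in> {1..r}" for a
  proof -
    have "a - 1 < length Y" using that by (auto simp: r_def)
    then have "Y ! (a - 1) \<in> insert (2, 0) (SIGMA s:{2..d}. BB s)" using Y nth_mem by blast
    then show ?thesis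
      using subspace_0[OF subspace_P] by (auto simp: ar_def el_def intro: subsetD[OF BB(2)])
  qed
  have Ydef: "n + ar a - 1 = n + \<delta> a" "0 < ar a" if "a \<in> {1..r}" for a n
    using Yin[OF that] by (auto simp: \<delta>_def)
  have Ysurj: "\<exists>a\<in>{1..r}. ar a = s \<and> el a = y" if "2 \<le> s" "s \<le> d" "y \<in> BB s" for s y
  proof -
    have "(s, y) \<in> set Y" using that by (simp add: Y)
    then obtain i where i: "i < length Y" "Y ! i = (s, y)" by (auto simp: in_set_conv_nth)
    then have "Suc i \<in> {1..r}" "ar (Suc i) = s" "el (Suc i) = y" by (auto simp: r_def ar_def el_def)
    then show ?thesis by blast
  qed
  have Gin: "w \<le> c j \<and> snd (G ! j) \<in> sign_eigenvectors (c j)" if "j < length G" for j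
  proof -
    have "G ! j \<in> (SIGMA n:{w..w + d}. EE n)" using that G nth_mem by blast
    then show ?thesis by (auto simp: c_def intro: subsetD[OF EE(2)])
  qed
  define C where "C n = (if w \<le> n then sign_eigenvectors n else {})" for n
  have Rw: "R a n x = pcomp n (ar a) 1 x (el a)" if "w \<le> n" for a n x
    using that w by (simp add: R_def)
  have one: "1 \<in> {1..n}" if "w \<le> n" for n using that w by simp
  interpret sc: sign_commuting_operators C R \<delta> r
  proof
    fix a x n assume a: "a \<in> {1..r}" and "x \<in> C n"
    then have x: "x \<in> sign_eigenvectors n" "w \<le> n" by (auto simp: C_def split: if_splits)
    have "P (n + ar a - 1) = alt_fixed (n + ar a - 1)" by (rule alt) (use x(2) Yin[OF a] in linarith)
    then have "pcomp n (ar a) 1 x (el a) \<in> sign_eigenvectors (n + ar a - 1)"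
      using Yin[OF a] by (intro pcomp_sign_eigenvector[OF x(1)]) auto
    then show "R a n x \<in> C (n + \<delta> a)" using Rw[OF x(2)] Ydef[OF a] x(2) by (simp add: C_def)
    show "R a n (- x) = - R a n x"
      unfolding Rw[OF x(2)] using Yin[OF a] by (intro pcomp_minus_left one x(2) sign_eigenvectors_P[OF x(1)]) auto
    fix b assume b: "b \<in> {1..r}"
    have "up_to_sign (pcomp (n + ar b - 1) (ar a) 1 (pcomp n (ar b) 1 x (el b)) (el a))
        (pcomp (n + ar a - 1) (ar b) 1 (pcomp n (ar a) 1 x (el a)) (el b))"
      using Yin[OF a] Yin[OF b] Ydef(2)[OF a] Ydef(2)[OF b] x(2) alt
      by (intro pcomp_commute_up_to_sign[OF x(1)]) auto
    then show "up_to_sign (R a (n + \<delta> b) (R b n x)) (R b (n + \<delta> a) (R a n x))"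
      unfolding Ydef(1)[OF a] Ydef(1)[OF b] using x(2) by (simp add: Rw)
  qed
  have gen_in: "snd (G ! (f 0)) \<in> C (c (f 0))" if "f \<in> exponents (length G) r" for f
    using Gin[of "f 0"] that by (auto simp: exponents_def C_def)
  have mon_C: "mon f \<in> C (weight c \<delta> r f)" if "f \<in> exponents (length G) r" for f
    unfolding mon_def by (rule sc.monomial_closed[where c = c and f = f, OF gen_in[OF that]])
  have mon_eig: "mon f \<in> sign_eigenvectors (weight c \<delta> r f)" if "f \<in> exponents (length G) r" for f
    using mon_C[OF that] by (auto simp: C_def split: if_splits)
  have R_mon: "up_to_sign (R a (weight c \<delta> r f) (mon f)) (mon (f(a := Suc (f a))))"
    if "f \<in> exponents (length G) r" "a \<in> {1..r}" for f a
    using sc.R_monomial[where c = c and f = f, OF that(2) gen_in[OF that(1)]] that(2) by (simp add: mon_def)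
  have M_span: "P n \<subseteq> span (mon ` {f \<in> exponents (length G) r. weight c \<delta> r f = n})" if "w \<le> n" for n
    using that
  proof (induction n rule: less_induct)
    case (less n)
    let ?S = "span (mon ` {f \<in> exponents (length G) r. weight c \<delta> r f = n})"
    show ?case
    proof (cases "n \<le> w + d")
      case True
      have "EE n \<subseteq> ?S"
      proof
        fix e assume "e \<in> EE n"
        then have "(n, e) \<in> set G" using True less(2) by (simp add: G)
        then obtain j where j: "j < length G" "G ! j = (n, e)" by (auto simp: in_set_conv_nth)
        define f where "f = (\<lambda>i::nat. 0::nat)(0 := j)"
        have f: "f \<in> exponents (length G) r" "f 0 = j" using j by (auto simp: f_def exponents_def)
        have nil: "canonical_word r f = []" by (rule canonical_word_Nil) (simp add: f_def)
        have "weight c \<delta> r f = n" "mon f = e"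
          using j f(2) nil by (simp_all add: weight_canonical_word mon_def c_def)
        then show "e \<in> ?S" using f(1) by (intro span_base) auto
      qed
      then have "span (EE n) \<subseteq> ?S" by (rule span_minimal[OF _ subspace_span])
      then show ?thesis using EE(3)[OF less(2)] by blast
    next
      case False
      have altn: "P n = alt_fixed n" by (rule alt[OF less(2)])
      have n2: "2 \<le> n" using less(2) w(1) by simp
      have sw: "sw permutes {1..n}" by (rule transpositions_permute[OF sw_in[OF n2]])
      have S_sw: "act n x sw \<in> ?S" if "x \<in> ?S" for x
      proof (rule act_span[OF sw subspace_span _ _ that])
        show "mon ` {f \<in> exponents (length G) r. weight c \<delta> r f = n} \<subseteq> P n"
          using mon_eig sign_eigenvectors_P by blast
        fix z assume "z \<in> mon ` {f \<in> exponents (length G) r. weight c \<delta> r f = n}"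
        then obtain f where f: "f \<in> exponents (length G) r" "weight c \<delta> r f = n" "z = mon f" by blast
        have "up_to_sign (act n z sw) z" using act_sign_eigenvector[OF mon_eig[OF f(1)]] sw f by simp
        moreover have "z \<in> ?S" using f by (intro span_base) auto
        ultimately show "act n z sw \<in> ?S" using span_neg by (auto simp: up_to_sign_def)
      qed
      have "top_composites d n \<subseteq> ?S"
      proof
        fix z assume "z \<in> top_composites d n"
        then obtain m s i x y \<sigma> where z: "z = act n (pcomp m s i x y) \<sigma>" and h: "i \<in> {1..m}" "2 \<le> s" "s \<le> d"
            "m + s - 1 = n" "x \<in> P m" "y \<in> P s" and \<sigma>: "\<sigma> permutes {1..n}"
          unfolding top_composites_def by blast
        have m: "w \<le> m" "m < n" "4 \<le> m" using h False w by auto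
        let ?T = "pcomp m s 1 x y"
        have 1: "1 \<in> {1..m}" by (rule one[OF m(1)])
        have xspan: "x \<in> span (mon ` {f \<in> exponents (length G) r. weight c \<delta> r f = m})"
          using less(1)[OF m(2,1)] h(5) by blast
        have TS: "?T \<in> ?S"
        proof (rule pcomp_span_right[OF 1 h(5) subspace_span BB(2)])
          show "y \<in> span (BB s)" using BB(3) h(6) by simp
          fix y assume y: "y \<in> BB s"
          obtain a where a: "a \<in> {1..r}" "ar a = s" "el a = y" using Ysurj[OF h(2,3) y] by blast
          have yP: "y \<in> P s" using y BB(2) by blast
          show "pcomp m s 1 x y \<in> ?S"
          proof (rule pcomp_span_left[OF 1 yP subspace_span _ _ xspan])
            show "mon ` {f \<in> exponents (length G) r. weight c \<delta> r f = m} \<subseteq> P m"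
              using mon_eig sign_eigenvectors_P by blast
            fix u assume "u \<in> mon ` {f \<in> exponents (length G) r. weight c \<delta> r f = m}"
            then obtain f where f: "f \<in> exponents (length G) r" "weight c \<delta> r f = m" "u = mon f" by blast
            have "up_to_sign (pcomp m s 1 u y) (mon (f(a := Suc (f a))))"
              using R_mon[OF f(1) a(1)] Rw[OF m(1)] a f by simp
            moreover have "weight c \<delta> r (f(a := Suc (f a))) = n"
              using weight_Suc[OF a(1)] f(2) h(4) Ydef(1)[OF a(1), of m] a(2) by simp
            then have "mon (f(a := Suc (f a))) \<in> ?S"
              using exponents_upd[OF f(1) a(1)] by (intro span_base) auto
            ultimately show "pcomp m s 1 u y \<in> ?S" using span_neg by (auto simp: up_to_sign_def)
          qed
        qed
        have xa: "x \<in> alt_fixed m" using h(5) alt[OF m(1)] by simp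
        obtain \<pi> where \<pi>: "\<pi> permutes {1..n}" "pcomp m s i x y = act n ?T \<pi>"
          using pcomp_change_input[OF 1 h(1) m(3) _ xa h(6)] h(2,4) by auto
        have TP: "?T \<in> P n" using pcomp_closed[OF 1 h(5,6)] h(4) by simp
        have "z = act n ?T (\<pi> \<circ> \<sigma>)" using z \<pi> act_compose[OF \<pi>(1) \<sigma> TP] by simp
        then have "z = ?T \<or> z = act n ?T sw"
          using act_on_alt_fixed[OF _ n2 permutes_compose[OF \<sigma> \<pi>(1)], of ?T] TP altn by simp
        then show "z \<in> ?S" using TS S_sw by auto
      qed
      then have "span (top_composites d n) \<subseteq> ?S" by (rule span_minimal[OF _ subspace_span])
      then show ?thesis using span[of n] False w by simp
    qed
  qed
  have P0: "x = 0" if "x \<in> P 0" for x using that red by (simp add: reduced_def)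
  have "monomial_module scale P R c \<delta> (length G) r w mon"
  proof unfold_locales
    show "0 < r" using Y by (auto simp: r_def)
    show "subspace (P n)" for n by (rule subspace_P)
    show "\<exists>B. finite B \<and> B \<subseteq> P n \<and> span B = P n" for n
      by (intro exI[of _ "BB n"] conjI BB)
    show "P n \<subseteq> span (mon ` {f \<in> exponents (length G) r. weight c \<delta> r f = n})" if "w \<le> n" for n
      by (rule M_span[OF that])
    show "\<forall>\<^sub>F n in sequentially. real (\<Sum>i\<le>n. dim (P i)) \<le> real n powr (3/2)" by (rule growth)
    fix f assume f: "f \<in> exponents (length G) r"
    show "mon f \<in> P (weight c \<delta> r f)" by (rule sign_eigenvectors_P[OF mon_eig[OF f]])
  next
    fix f a assume f: "f \<in> exponents (length G) r" and a: "a \<in> {1..r}"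
    show "R a (weight c \<delta> r f) (mon f) = mon (f(a := Suc (f a))) \<or>
          R a (weight c \<delta> r f) (mon f) = - mon (f(a := Suc (f a)))"
      using R_mon[OF f a] by (simp add: up_to_sign_def)
  next
    fix a assume a: "a \<in> {1..r}"
    show "0 < \<delta> a" using Yin[OF a] by (auto simp: \<delta>_def)
    fix x n assume x: "x \<in> P n"
    note ya = Yin[OF a, THEN conjunct2]
    show "R a n x \<in> P (n + \<delta> a)"
      using pcomp_closed[OF _ x ya, of 1] subspace_0[OF subspace_P] Ydef(1)[OF a, of n] by (simp add: R_def)
    show "R a n (scale k x) = scale k (R a n x)" for k
      using pcomp_scale_left[OF _ x ya, of 1] by (simp add: R_def)
    show "R a n (x + y) = R a n x + R a n y" if "y \<in> P n" for y
      using pcomp_add_left[OF _ x that ya, of 1] by (simp add: R_def)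
  qed
  then have "(\<forall>a\<in>{1..length Y}. 2 \<le> fst (Y ! (a - 1)) \<and> snd (Y ! (a - 1)) \<in> P (fst (Y ! (a - 1)))) \<and>
    monomial_module scale P
      (\<lambda>a n x. if n = 0 then 0 else pcomp n (fst (Y ! (a - 1))) 1 x (snd (Y ! (a - 1))))
      c (\<lambda>a. fst (Y ! (a - 1)) - 1) (length G) (length Y) w mon"
    using Yin unfolding R_def \<delta>_def ar_def el_def r_def by blast
  then show ?thesis by blast
qed

lemma rational_bounded_noetherian:
  assumes two: "(2::'k) \<noteq> 0" and red: "reduced" and lf: "locally_finite"
    and fg: "finitely_generated" and gk: "GKdim = 1"
  shows "(rational_fps hilbert_series \<and> uniformly_bounded) \<and> right_noetherian"
proof -
  note growth = growth_of_GKdim[OF gk]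
  obtain X where X: "finite X" "X \<subseteq> Sigma UNIV P" "\<And>n. generated_suboperad X n = P n"
    using fg unfolding finitely_generated_def by blast
  (* Any bound for the arities of the generators that is at least 2. *)
  define d where "d = 2 + (\<Sum>k\<in>fst ` X. k)"
  have d: "2 \<le> d" "1 \<le> d" by (auto simp: d_def)
  have dX: "k \<le> d" if "(k, x) \<in> X" for k x
  proof -
    have "k \<in> fst ` X" using that by force
    then have "k \<le> (\<Sum>k\<in>fst ` X. k)" using X(1) by (intro member_le_sum) auto
    then show ?thesis by (simp add: d_def)
  qed
  have span: "P k = span (top_composites d k)" if "d < k" for k
    by (rule top_composites_span[OF red X(3,2) dX d(2) that])
  obtain w0 where w0: "\<And>n. w0 \<le> n \<Longrightarrow> P n = alt_fixed n"
    using eventually_alt_fixed[OF lf two growth span d(2)] by blast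
  define w where "w = w0 + d + 4"
  have w: "4 \<le> w" "d \<le> w" "\<And>n. w \<le> n \<Longrightarrow> P n = alt_fixed n" using w0 by (auto simp: w_def)
  obtain Y c q mon where Y: "\<And>a. a \<in> {1..length Y} \<Longrightarrow>
        2 \<le> fst (Y ! (a - 1)) \<and> snd (Y ! (a - 1)) \<in> P (fst (Y ! (a - 1)))"
    and mm: "monomial_module scale P
      (\<lambda>a n x. if n = 0 then 0 else pcomp n (fst (Y ! (a - 1))) 1 x (snd (Y ! (a - 1))))
      c (\<lambda>a. fst (Y ! (a - 1)) - 1) q (length Y) w mon"
    using monomial_module_of_alt_fixed[OF two lf red growth span d(1) w] by blast
  obtain p n1 where p: "0 < p" "\<And>n. n1 \<le> n \<Longrightarrow> dim (P (n + p)) \<le> dim (P n)"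
    using monomial_module.dim_antitone_along_period[OF mm] by blast
  note steps = eventually_antitone_steps[of p n1 "\<lambda>n. dim (P n)", OF p]
  have "right_noetherian"
    unfolding right_noetherian_def
  proof (intro allI impI)
    fix I :: "nat \<Rightarrow> nat \<Rightarrow> 'a set"
    assume I: "(\<forall>k. right_ideal (I k)) \<and> (\<forall>k n. I k n \<subseteq> I (Suc k) n)"
    then have ideal: "right_ideal (I k)" for k by blast
    have sub: "subspace (I k n)" and IP: "I k n \<subseteq> P n" for k n
      using ideal[of k] unfolding right_ideal_def by blast+
    have closed: "pcomp m n i x \<mu> \<in> I k (m + n - 1)" if "i \<in> {1..m}" "x \<in> I k m" "\<mu> \<in> P n" for k m n i x \<mu>
      using ideal[of k] that unfolding right_ideal_def by blast
    show "\<exists>K. \<forall>k\<ge>K. \<forall>n. I k n = I K n"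
    proof (rule monomial_module.ascending_chain_condition[OF mm sub IP])
      show "I k n \<subseteq> I (Suc k) n" for k n using I by blast
      fix k a n x assume a: "a \<in> {1..length Y}" and x: "x \<in> I k n"
      have eq: "n + (fst (Y ! (a - 1)) - 1) = n + fst (Y ! (a - 1)) - 1" using Y[OF a] by simp
      show "(if n = 0 then 0 else pcomp n (fst (Y ! (a - 1))) 1 x (snd (Y ! (a - 1))))
          \<in> I k (n + (fst (Y ! (a - 1)) - 1))"
        unfolding eq using closed[of 1 n x k, OF _ x] Y[OF a] subspace_0[OF sub] by simp
    qed
  qed
  moreover have "rational_fps hilbert_series"
    unfolding hilbert_series_def by (rule steps(2))
  moreover have "uniformly_bounded" unfolding uniformly_bounded_def by (rule steps(1))
  ultimately show ?thesis by blast
qed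

end

theorem theorem0p5:
  fixes scale :: "'k::field \<Rightarrow> 'a::ab_group_add \<Rightarrow> 'a"
    and P :: "nat \<Rightarrow> 'a set"
    and act :: "nat \<Rightarrow> 'a \<Rightarrow> (nat \<Rightarrow> nat) \<Rightarrow> 'a"
    and unit :: 'a
    and pcomp :: "nat \<Rightarrow> nat \<Rightarrow> nat \<Rightarrow> 'a \<Rightarrow> 'a \<Rightarrow> 'a"
  assumes "CHAR('k) \<noteq> 2"
    and "symmetric_operad scale P act unit pcomp"
    and "symmetric_operad.reduced P"
    and "symmetric_operad.locally_finite scale P"
    and "symmetric_operad.finitely_generated scale P act unit pcomp"
    and "symmetric_operad.GKdim scale P = 1"
  shows "(rational_fps (symmetric_operad.hilbert_series scale P) \<and>
          symmetric_operad.uniformly_bounded scale P) \<and>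
         symmetric_operad.right_noetherian scale P act pcomp"
proof -
  have "(2::'k) \<noteq> 0"
  proof
    assume "(2::'k) = 0"
    then have "of_nat 2 = (0::'k)" by simp
    then have dvd: "CHAR('k) dvd 2" by (simp only: of_nat_eq_0_iff_char_dvd)
    have "CHAR('k) \<le> 2" by (rule dvd_imp_le[OF dvd]) simp
    moreover have "CHAR('k) \<noteq> 0" using dvd by (intro notI) simp
    moreover have "CHAR('k) \<noteq> 1" using of_nat_eq_0_iff_char_dvd[of 1, where 'a = 'k] by auto
    ultimately show False using assms(1) by linarith
  qed
  then show ?thesis
    by (rule symmetric_operad.rational_bounded_noetherian[OF assms(2) _ assms(3-6)])
qed

end
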